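(* Let $B$ be a unital Banach algebra over $\mathbb{C}$ and let $\theta\in B^d$ with $\theta(1)=1$. For any $\xi\in\mathcal{Z}(B^d)^{\otimes2}$ the following conditions are equivalent: (1) there exists $q\in\mathcal{Z}(B^d)$ such that $\partial[q]=\xi$; (2) $(\partial\otimes\mathrm{id})[\xi]=(\mathrm{id}\otimes\partial)[\xi]$; (3) $(\partial\circ\partial_\theta^* )[\xi]=N_{\theta,2}[\xi]$.
   Context: $B^d$ is the topological dual of $B$; $M_n(B)=M_n(\mathbb{C})\otimes B$ with its natural (entrywise) topology; $M(B)=(M_n(B))_{n\ge1}$. $A(M(B))$ is the unital algebra (levelwise operations) of families $f=(f_n)_{n\ge1}$ of analytic maps $f_n:M_n(B)\to M_n(\mathbb{C})$ with $f_{m+n}(\beta\oplus\beta')=f_m(\beta)\oplus f_n(\beta')$ and $f_n((s\otimes1)\beta(s\otimes1)^{-1})=sf_n(\beta)s^{-1}$ for $s\in GL_n(\mathbb{C})$. $A(M(B);M(B))$ is the space of families of analytic maps $f_{m;n}:M_m(B)\times M_n(B)\to M_m(\mathbb{C})\otimes M_n(\mathbb{C})$ having these properties in each variable separately (acting on the corresponding tensor leg). For $\varphi\in B^d$, $z(\varphi)\in A(M(B))$ is $z(\varphi)_n=\mathrm{id}_{M_n(\mathbb{C})}\otimes\varphi$ (apply $\varphi$ entrywise). $\mathcal{Z}(B^d)$ is the unital subalgebra of $A(M(B))$ generated by $\{z(\varphi):\varphi\in B^d\}$. The algebraic tensor product $\mathcal{Z}(B^d)^{\otimes2}$ is viewed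 inside $A(M(B);M(B))$ via $(f\otimes g)_{m;n}(\beta;\beta')=f_m(\beta)\otimes g_n(\beta')$. $\partial:A(M(B))\to A(M(B);M(B))$ is $$(\partial f)_{m;n}(\beta;\beta')=\sum_{1\le a,b\le m,\,1\le c,d\le n}\Big(\tfrac{d}{d\epsilon}f_{m+n}\big(\left[\begin{smallmatrix}\beta&\epsilon e^{(m,n)}_{b,c}\otimes1\\0&\beta'\end{smallmatrix}\right]\big)\big|_{\epsilon=0}\Big)_{(a,m+d)}e^{(m)}_{a,b}\otimes e^{(n)}_{c,d}$$ ($e$'s are matrix units). It is a derivation with $\partial[z(\varphi)]=\varphi(1)\,1\otimes1$, and it maps $\mathcal{Z}(B^d)$ into $\mathcal{Z}(B^d)^{\otimes2}$; on $\mathcal{Z}(B^d)^{\otimes2}$ the maps $\partial\otimes\mathrm{id}$ and $\mathrm{id}\otimes\partial$ into $\mathcal{Z}(B^d)^{\otimes3}$ are the usual algebraic tensor product maps. $\partial_\theta^*$ is $(\partial_\theta^*f)_n(\beta)=f_{n;n}(\beta;\beta)\#z(\theta)_n(\beta)$ with $(a\otimes c)\#b=abc$; thus on $\mathcal{Z}(B^d)^{\otimes2}$, $\partial_\theta^*[f\otimes g]=f\,z(\theta)\,g$. $N_\theta=\partial_\theta^*\circ\partial$, and on $\mathcal{Z}(B^d)^{\otimes2}$, $N_{\theta,2}=N_\theta\otimes\mathrm{id}+\mathrm{id}\otimes N_\theta+\mathrm{id}$. *)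

theory Defs
  imports
    "HOL-Analysis.Analysis"
    "HOL-Library.Function_Algebras"
    "Jordan_Normal_Form.Matrix"
begin

hide_const (open) Finite_Cartesian_Product.mat

section \<open>Unital complex Banach algebras and their topological duals\<close>

class scaleC =
  fixes scaleC :: "complex \<Rightarrow> 'a \<Rightarrow> 'a"  (infixr "*\<^sub>C" 75)

text \<open>The unit is not required to have norm one; \<^const>\<open>norm\<close> is submultiplicative and complete.\<close>

class complex_unital_banach_algebra = real_normed_algebra + real_algebra_1 + banach + scaleC +
  assumes scaleC_add_right: "c *\<^sub>C (x + y) = c *\<^sub>C x + c *\<^sub>C y"
    and scaleC_add_left: "(c + d) *\<^sub>C x = c *\<^sub>C x + d *\<^sub>C x"
    and scaleC_scaleC: "c *\<^sub>C (d *\<^sub>C x) = (c * d) *\<^sub>C x"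
    and scaleC_one: "1 *\<^sub>C x = x"
    and scaleC_of_real: "complex_of_real r *\<^sub>C x = r *\<^sub>R x"
    and mult_scaleC_left: "(c *\<^sub>C x) * y = c *\<^sub>C (x * y)"
    and mult_scaleC_right: "x * (c *\<^sub>C y) = c *\<^sub>C (x * y)"
    and norm_scaleC: "norm (c *\<^sub>C x) = cmod c * norm x"

instantiation complex :: complex_unital_banach_algebra
begin
definition scaleC_complex :: "complex \<Rightarrow> complex \<Rightarrow> complex" where
  "scaleC_complex c x = c * x"
instance
  by standard (auto simp: scaleC_complex_def algebra_simps norm_mult scaleR_conv_of_real)
end

definition top_dual :: "('b::complex_unital_banach_algebra \<Rightarrow> complex) set" where
  "top_dual = {\<phi>. Vector_Spaces.linear scaleC (*) \<phi> \<and> continuous_on UNIV \<phi>}"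


section \<open>The algebra of analytic families of maps\<close>

text \<open>
  A family \<open>f\<close> of maps from \<open>M\<^sub>n(B)\<close> to \<open>M\<^sub>n(\<complex>)\<close> is a HOL function whose value \<open>f n \<beta>\<close> is normalised
  to be the zero matrix when \<open>\<beta>\<close> is not an \<open>n \<times> n\<close> matrix, so that equality of families is HOL
  equality. The level \<open>n = 0\<close> is present but carries no information, since \<open>M\<^sub>0(\<complex>)\<close> has only
  one element.
\<close>

type_synonym 'b fam = "nat \<Rightarrow> 'b mat \<Rightarrow> complex mat"

definition fam_one :: "'b fam" where
  "fam_one = (\<lambda>n \<beta>. if \<beta> \<in> carrier_mat n n then 1\<^sub>m n else 0\<^sub>m n n)"

definition fam_add :: "'b fam \<Rightarrow> 'b fam \<Rightarrow> 'b fam" where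
  "fam_add f g = (\<lambda>n \<beta>. f n \<beta> + g n \<beta>)"

definition fam_mult :: "'b fam \<Rightarrow> 'b fam \<Rightarrow> 'b fam" where
  "fam_mult f g = (\<lambda>n \<beta>. f n \<beta> * g n \<beta>)"

definition fam_scale :: "complex \<Rightarrow> 'b fam \<Rightarrow> 'b fam" where
  "fam_scale c f = (\<lambda>n \<beta>. c \<cdot>\<^sub>m f n \<beta>)"

definition fam_z :: "('b \<Rightarrow> complex) \<Rightarrow> 'b fam" where
  "fam_z \<phi> = (\<lambda>n \<beta>. if \<beta> \<in> carrier_mat n n then map_mat \<phi> \<beta> else 0\<^sub>m n n)"

definition mat_dsum :: "'a::zero mat \<Rightarrow> 'a mat \<Rightarrow> 'a mat" where
  "mat_dsum A D = four_block_mat A (0\<^sub>m (dim_row A) (dim_col D)) (0\<^sub>m (dim_row D) (dim_col A)) D"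

text \<open>\<open>ampl s\<close> is \<open>s \<otimes> 1\<close>.\<close>

definition ampl :: "complex mat \<Rightarrow> 'b::complex_unital_banach_algebra mat" where
  "ampl s = map_mat (\<lambda>c. c *\<^sub>C 1) s"

text \<open>
  A map between complex Banach spaces is analytic when it is continuous and analytic along every
  complex affine line. Continuity refers to the entrywise topology of \<open>M\<^sub>n(B)\<close>, which is obtained
  from the product topology on \<open>nat \<times> nat \<Rightarrow> 'b\<close> through \<open>mat n n\<close>.
\<close>

definition analytic_level ::
    "nat \<Rightarrow> ('b::complex_unital_banach_algebra mat \<Rightarrow> complex mat) \<Rightarrow> bool" where
  "analytic_level n F \<longleftrightarrow> (\<forall>i<n. \<forall>j<n.
     continuous_on UNIV (\<lambda>x :: nat \<times> nat \<Rightarrow> 'b. F (mat n n x) $$ (i, j)) \<and>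
     (\<forall>\<beta>\<in>carrier_mat n n. \<forall>\<gamma>\<in>carrier_mat n n.
        (\<lambda>\<zeta>. F (\<beta> + map_mat (scaleC \<zeta>) \<gamma>) $$ (i, j)) analytic_on UNIV))"

text \<open>\<open>fam_A\<close> is \<open>A(M(B))\<close>.\<close>

definition fam_A :: "'b::complex_unital_banach_algebra fam set" where
  "fam_A = {f.
     (\<forall>n \<beta>. f n \<beta> \<in> carrier_mat n n) \<and>
     (\<forall>n \<beta>. \<beta> \<notin> carrier_mat n n \<longrightarrow> f n \<beta> = 0\<^sub>m n n) \<and>
     (\<forall>n. analytic_level n (f n)) \<and>
     (\<forall>m n. \<forall>\<beta>\<in>carrier_mat m m. \<forall>\<beta>'\<in>carrier_mat n n.
        f (m + n) (mat_dsum \<beta> \<beta>') = mat_dsum (f m \<beta>) (f n \<beta>')) \<and>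
     (\<forall>n. \<forall>\<beta>\<in>carrier_mat n n. \<forall>s\<in>carrier_mat n n. \<forall>t\<in>carrier_mat n n.
        s * t = 1\<^sub>m n \<and> t * s = 1\<^sub>m n \<longrightarrow> f n (ampl s * \<beta> * ampl t) = s * f n \<beta> * t)}"

definition unital_subalgebra :: "'b::complex_unital_banach_algebra fam set \<Rightarrow> bool" where
  "unital_subalgebra S \<longleftrightarrow> S \<subseteq> fam_A \<and> fam_one \<in> S \<and>
     (\<forall>f\<in>S. \<forall>g\<in>S. fam_add f g \<in> S \<and> fam_mult f g \<in> S) \<and>
     (\<forall>c. \<forall>f\<in>S. fam_scale c f \<in> S)"

definition fam_Z :: "'b::complex_unital_banach_algebra fam set" where
  "fam_Z = unital_subalgebra hull (fam_z ` top_dual)"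


section \<open>Families of two and three variables\<close>

text \<open>
  A value in \<open>M\<^sub>m(\<complex>) \<otimes> M\<^sub>n(\<complex>)\<close> is given by its coefficients: \<open>h m n \<beta> \<beta>' (a, b) (c, d)\<close> is the
  coefficient of \<open>e\<^sub>a\<^sub>b \<otimes> e\<^sub>c\<^sub>d\<close> (indices start at 0), and is 0 when an index is out of range or when
  \<open>\<beta>\<close>, \<open>\<beta>'\<close> have the wrong size; similarly for three variables. The vector space operations are
  thus those of \<^theory>\<open>HOL-Library.Function_Algebras\<close>.
\<close>

type_synonym 'b fam2 =
  "nat \<Rightarrow> nat \<Rightarrow> 'b mat \<Rightarrow> 'b mat \<Rightarrow> nat \<times> nat \<Rightarrow> nat \<times> nat \<Rightarrow> complex"

type_synonym 'b fam3 =
  "nat \<Rightarrow> nat \<Rightarrow> nat \<Rightarrow> 'b mat \<Rightarrow> 'b mat \<Rightarrow> 'b mat \<Rightarrow>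
   nat \<times> nat \<Rightarrow> nat \<times> nat \<Rightarrow> nat \<times> nat \<Rightarrow> complex"

definition coeff_mat :: "complex mat \<Rightarrow> nat \<times> nat \<Rightarrow> complex" where
  "coeff_mat A u = (if fst u < dim_row A \<and> snd u < dim_col A then A $$ u else 0)"

definition tensor :: "'b fam \<Rightarrow> 'b fam \<Rightarrow> 'b fam2"  (infixl "\<otimes>\<^sub>f" 70) where
  "f \<otimes>\<^sub>f g = (\<lambda>m n \<beta> \<beta>' u v. coeff_mat (f m \<beta>) u * coeff_mat (g n \<beta>') v)"

definition tensor21 :: "'b fam2 \<Rightarrow> 'b fam \<Rightarrow> 'b fam3" where
  "tensor21 h g = (\<lambda>m n p \<beta> \<beta>' \<beta>'' u v w. h m n \<beta> \<beta>' u v * coeff_mat (g p \<beta>'') w)"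

definition tensor12 :: "'b fam \<Rightarrow> 'b fam2 \<Rightarrow> 'b fam3" where
  "tensor12 f h = (\<lambda>m n p \<beta> \<beta>' \<beta>'' u v w. coeff_mat (f m \<beta>) u * h n p \<beta>' \<beta>'' v w)"

text \<open>The algebraic tensor square of \<open>fam_Z\<close>, viewed inside the two-variable families.\<close>

definition fam_Z2 :: "'b::complex_unital_banach_algebra fam2 set" where
  "fam_Z2 = {\<xi>. \<exists>k f g. (\<forall>i<k. f i \<in> fam_Z \<and> g i \<in> fam_Z) \<and>
                        \<xi> = (\<Sum>i<(k::nat). f i \<otimes>\<^sub>f g i)}"

text \<open>
  The linear map on \<open>fam_Z2\<close> induced by a bilinear map \<open>\<Phi>\<close> on \<open>fam_Z \<times> fam_Z\<close>, i.e. the one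
  sending \<open>f \<otimes>\<^sub>f g\<close> to \<open>\<Phi> f g\<close>. For each use below, independence of the decomposition is proved at
  the end of this theory.
\<close>

definition tensor_lift ::
    "('b::complex_unital_banach_algebra fam \<Rightarrow> 'b fam \<Rightarrow> 'c::comm_monoid_add) \<Rightarrow> 'b fam2 \<Rightarrow> 'c" where
  "tensor_lift \<Phi> \<xi> = (THE \<eta>. \<exists>k f g. (\<forall>i<k. f i \<in> fam_Z \<and> g i \<in> fam_Z) \<and>
      \<xi> = (\<Sum>i<(k::nat). f i \<otimes>\<^sub>f g i) \<and> \<eta> = (\<Sum>i<k. \<Phi> (f i) (g i)))"


section \<open>The free difference quotient, its adjoint, and the number operators\<close>

text \<open>\<open>scaled_unit m n b c \<epsilon>\<close> is \<open>\<epsilon> e\<^sub>b\<^sub>c \<otimes> 1\<close> with \<open>e\<^sub>b\<^sub>c\<close> an \<open>m \<times> n\<close> matrix unit.\<close>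

definition scaled_unit ::
    "nat \<Rightarrow> nat \<Rightarrow> nat \<Rightarrow> nat \<Rightarrow> complex \<Rightarrow> 'b::complex_unital_banach_algebra mat" where
  "scaled_unit m n b c \<epsilon> = mat m n (\<lambda>u. if u = (b, c) then \<epsilon> *\<^sub>C 1 else 0)"

definition del :: "'b::complex_unital_banach_algebra fam \<Rightarrow> 'b fam2" where
  "del f = (\<lambda>m n \<beta> \<beta>' (a, b) (c, d).
     if \<beta> \<in> carrier_mat m m \<and> \<beta>' \<in> carrier_mat n n \<and> a < m \<and> b < m \<and> c < n \<and> d < n
     then deriv (\<lambda>\<epsilon>. f (m + n)
            (four_block_mat \<beta> (scaled_unit m n b c \<epsilon>) (0\<^sub>m n m) \<beta>') $$ (a, m + d)) 0
     else 0)"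

text \<open>
  \<open>sharp n t x\<close> is \<open>t # x\<close> for \<open>t \<in> M\<^sub>n(\<complex>) \<otimes> M\<^sub>n(\<complex>)\<close> and \<open>x \<in> M\<^sub>n(\<complex>)\<close>, where
  \<open>(a \<otimes> c) # x = a x c\<close>.
\<close>

definition sharp ::
    "nat \<Rightarrow> (nat \<times> nat \<Rightarrow> nat \<times> nat \<Rightarrow> complex) \<Rightarrow> complex mat \<Rightarrow> complex mat" where
  "sharp n t x = mat n n (\<lambda>(i, j). \<Sum>k<n. \<Sum>l<n. t (i, k) (l, j) * x $$ (k, l))"

definition del_star ::
    "('b::complex_unital_banach_algebra \<Rightarrow> complex) \<Rightarrow> 'b fam2 \<Rightarrow> 'b fam" where
  "del_star \<theta> h = (\<lambda>n \<beta>. sharp n (h n n \<beta> \<beta>) (fam_z \<theta> n \<beta>))"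

definition num_op ::
    "('b::complex_unital_banach_algebra \<Rightarrow> complex) \<Rightarrow> 'b fam \<Rightarrow> 'b fam" where
  "num_op \<theta> = del_star \<theta> \<circ> del"

definition del_id :: "'b::complex_unital_banach_algebra fam2 \<Rightarrow> 'b fam3" where
  "del_id = tensor_lift (\<lambda>f g. tensor21 (del f) g)"

definition id_del :: "'b::complex_unital_banach_algebra fam2 \<Rightarrow> 'b fam3" where
  "id_del = tensor_lift (\<lambda>f g. tensor12 f (del g))"

definition num_op2 ::
    "('b::complex_unital_banach_algebra \<Rightarrow> complex) \<Rightarrow> 'b fam2 \<Rightarrow> 'b fam2" where
  "num_op2 \<theta> \<xi> = tensor_lift (\<lambda>f g. num_op \<theta> f \<otimes>\<^sub>f g) \<xi>
                 + tensor_lift (\<lambda>f g. f \<otimes>\<^sub>f num_op \<theta> g) \<xi> + \<xi>"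


section \<open>Well-formedness of the definitions\<close>

lemma vector_space_scaleC: "vector_space (scaleC :: complex \<Rightarrow> 'b::complex_unital_banach_algebra \<Rightarrow> 'b)"
  by standard (auto simp: scaleC_add_right scaleC_add_left scaleC_scaleC scaleC_one)

lemma scaleC_zero_right [simp]: "c *\<^sub>C (0::'b::complex_unital_banach_algebra) = 0"
  using scaleC_add_right[of c 0 0] by simp

lemma scaleC_zero_left [simp]: "0 *\<^sub>C (x::'b::complex_unital_banach_algebra) = 0"
  using scaleC_add_left[of 0 0 x] by simp

lemma top_dualD:
  assumes "\<phi> \<in> top_dual"
  shows "\<phi> (x + y) = \<phi> x + \<phi> y" "\<phi> (c *\<^sub>C x) = c * \<phi> x" "\<phi> 0 = 0"
    "continuous_on UNIV \<phi>"
proof -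
  have l: "Vector_Spaces.linear scaleC (*) \<phi>" and c: "continuous_on UNIV \<phi>"
    using assms by (auto simp: top_dual_def)
  interpret Vector_Spaces.linear scaleC "(*)" \<phi> by (rule l)
  show "\<phi> (x + y) = \<phi> x + \<phi> y" "\<phi> (c *\<^sub>C x) = c * \<phi> x" "\<phi> 0 = 0"
    by (auto simp: add scale)
  show "continuous_on UNIV \<phi>" by (rule c)
qed

lemma top_dual_sum:
  assumes "\<phi> \<in> top_dual"
  shows "\<phi> (sum f A) = (\<Sum>x\<in>A. \<phi> (f x))"
  by (induction A rule: infinite_finite_induct) (simp_all add: top_dualD[OF assms])

lemma mat_dsum_carrier:
  "A \<in> carrier_mat m m \<Longrightarrow> D \<in> carrier_mat n n \<Longrightarrow> mat_dsum A D \<in> carrier_mat (m + n) (m + n)"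
  by (auto simp: mat_dsum_def)

lemma mult_entry:
  assumes "A \<in> carrier_mat n n" "B \<in> carrier_mat n n" "i < n" "j < n"
  shows "(A * B) $$ (i, j) = (\<Sum>k<n. A $$ (i, k) * B $$ (k, j))"
  using assms by (auto simp: scalar_prod_def atLeast0LessThan intro!: sum.cong)

lemma ampl_conj_carrier:
  assumes "\<beta> \<in> carrier_mat n n" "s \<in> carrier_mat n n" "t \<in> carrier_mat n n"
  shows "ampl s * \<beta> * ampl t \<in> carrier_mat n n"
  using assms by (auto simp: ampl_def)

lemma map_ampl_left:
  assumes "\<phi> \<in> top_dual" "\<beta> \<in> carrier_mat n n" "s \<in> carrier_mat n n"
  shows "map_mat \<phi> (ampl s * \<beta>) = s * map_mat \<phi> \<beta>"
proof (rule eq_matI)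
  fix i j assume "i < dim_row (s * map_mat \<phi> \<beta>)" "j < dim_col (s * map_mat \<phi> \<beta>)"
  then have ij: "i < n" "j < n" using assms by auto
  have [simp]: "ampl s \<in> carrier_mat n n" using assms by (auto simp: ampl_def)
  have "map_mat \<phi> (ampl s * \<beta>) $$ (i, j) = \<phi> ((ampl s * \<beta>) $$ (i, j))"
    using assms ij by (subst index_map_mat) (auto simp: ampl_def)
  also have "\<dots> = (\<Sum>k<n. \<phi> (ampl s $$ (i, k) * \<beta> $$ (k, j)))"
    using assms ij by (subst mult_entry[of _ n]) (auto simp: top_dual_sum)
  also have "\<dots> = (\<Sum>k<n. s $$ (i, k) * map_mat \<phi> \<beta> $$ (k, j))"
    using assms ij
    by (intro sum.cong) (auto simp: ampl_def mult_scaleC_left top_dualD[OF assms(1)])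
  also have "\<dots> = (s * map_mat \<phi> \<beta>) $$ (i, j)"
    using assms ij by (subst mult_entry[of _ n]) auto
  finally show "map_mat \<phi> (ampl s * \<beta>) $$ (i, j) = (s * map_mat \<phi> \<beta>) $$ (i, j)" .
qed (use assms in \<open>auto simp: ampl_def\<close>)

lemma map_ampl_right:
  assumes "\<phi> \<in> top_dual" "\<beta> \<in> carrier_mat n n" "t \<in> carrier_mat n n"
  shows "map_mat \<phi> (\<beta> * ampl t) = map_mat \<phi> \<beta> * t"
proof (rule eq_matI)
  fix i j assume "i < dim_row (map_mat \<phi> \<beta> * t)" "j < dim_col (map_mat \<phi> \<beta> * t)"
  then have ij: "i < n" "j < n" using assms by auto
  have [simp]: "ampl t \<in> carrier_mat n n" using assms by (auto simp: ampl_def)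
  have "map_mat \<phi> (\<beta> * ampl t) $$ (i, j) = \<phi> ((\<beta> * ampl t) $$ (i, j))"
    using assms ij by (subst index_map_mat) (auto simp: ampl_def)
  also have "\<dots> = (\<Sum>k<n. \<phi> (\<beta> $$ (i, k) * ampl t $$ (k, j)))"
    using assms ij by (subst mult_entry[of _ n]) (auto simp: top_dual_sum)
  also have "\<dots> = (\<Sum>k<n. map_mat \<phi> \<beta> $$ (i, k) * t $$ (k, j))"
    using assms ij
    by (intro sum.cong) (auto simp: ampl_def mult_scaleC_right top_dualD[OF assms(1)])
  also have "\<dots> = (map_mat \<phi> \<beta> * t) $$ (i, j)"
    using assms ij by (subst mult_entry[of _ n]) auto
  finally show "map_mat \<phi> (\<beta> * ampl t) $$ (i, j) = (map_mat \<phi> \<beta> * t) $$ (i, j)" .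
qed (use assms in \<open>auto simp: ampl_def\<close>)

lemma map_ampl_conj:
  assumes "\<phi> \<in> top_dual" "\<beta> \<in> carrier_mat n n" "s \<in> carrier_mat n n" "t \<in> carrier_mat n n"
  shows "map_mat \<phi> (ampl s * \<beta> * ampl t) = s * map_mat \<phi> \<beta> * t"
proof -
  have "ampl s * \<beta> \<in> carrier_mat n n" using assms by (auto simp: ampl_def)
  then show ?thesis
    using map_ampl_right[OF assms(1) _ assms(4)] map_ampl_left[OF assms(1-3)] by metis
qed

subsection \<open>\<open>A(M(B))\<close> is a unital algebra containing the generators\<close>

lemma fam_z_in_A:
  assumes "\<phi> \<in> top_dual"
  shows "fam_z \<phi> \<in> fam_A"
proof -
  have "analytic_level n (fam_z \<phi> n)" for n
    unfolding analytic_level_def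
  proof (intro allI impI conjI ballI)
    fix i j assume ij: "i < n" "j < n"
    have "continuous_on UNIV (\<lambda>x :: nat \<times> nat \<Rightarrow> 'a. \<phi> (x (i, j)))"
      by (rule continuous_on_compose2[OF top_dualD(4)[OF assms]])
        (auto intro!: continuous_on_product_coordinates)
    then show "continuous_on UNIV (\<lambda>x :: nat \<times> nat \<Rightarrow> 'a. fam_z \<phi> n (mat n n x) $$ (i, j))"
      using ij by (simp add: fam_z_def)
    fix \<beta> \<gamma> :: "'a mat" assume bg: "\<beta> \<in> carrier_mat n n" "\<gamma> \<in> carrier_mat n n"
    have "(\<lambda>\<zeta>. \<phi> (\<beta> $$ (i, j)) + \<zeta> * \<phi> (\<gamma> $$ (i, j))) analytic_on UNIV"
      by (intro analytic_intros)
    also have "(\<lambda>\<zeta>. \<phi> (\<beta> $$ (i, j)) + \<zeta> * \<phi> (\<gamma> $$ (i, j))) =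
        (\<lambda>\<zeta>. fam_z \<phi> n (\<beta> + map_mat (scaleC \<zeta>) \<gamma>) $$ (i, j))"
      using ij bg by (auto simp: fam_z_def top_dualD[OF assms])
    finally show "(\<lambda>\<zeta>. fam_z \<phi> n (\<beta> + map_mat (scaleC \<zeta>) \<gamma>) $$ (i, j)) analytic_on UNIV" .
  qed
  moreover have "fam_z \<phi> (m + n) (mat_dsum \<beta> \<beta>') = mat_dsum (fam_z \<phi> m \<beta>) (fam_z \<phi> n \<beta>')"
    if "\<beta> \<in> carrier_mat m m" "\<beta>' \<in> carrier_mat n n" for m n \<beta> \<beta>'
    using that mat_dsum_carrier[OF that]
    by (intro eq_matI) (auto simp: fam_z_def mat_dsum_def top_dualD[OF assms])
  moreover have "fam_z \<phi> n (ampl s * \<beta> * ampl t) = s * fam_z \<phi> n \<beta> * t"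
    if "\<beta> \<in> carrier_mat n n" "s \<in> carrier_mat n n" "t \<in> carrier_mat n n" for n \<beta> s t
    using that ampl_conj_carrier[OF that] map_ampl_conj[OF assms that] by (simp add: fam_z_def)
  ultimately show ?thesis
    unfolding fam_A_def by (auto simp: fam_z_def)
qed

lemma fam_AD:
  assumes "f \<in> fam_A"
  shows "f n \<beta> \<in> carrier_mat n n"
    "\<beta> \<notin> carrier_mat n n \<Longrightarrow> f n \<beta> = 0\<^sub>m n n"
    "analytic_level n (f n)"
    "\<beta>1 \<in> carrier_mat m m \<Longrightarrow> \<beta>2 \<in> carrier_mat n n \<Longrightarrow>
      f (m + n) (mat_dsum \<beta>1 \<beta>2) = mat_dsum (f m \<beta>1) (f n \<beta>2)"
    "\<beta> \<in> carrier_mat n n \<Longrightarrow> s \<in> carrier_mat n n \<Longrightarrow> t \<in> carrier_mat n n \<Longrightarrow>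
      s * t = 1\<^sub>m n \<Longrightarrow> t * s = 1\<^sub>m n \<Longrightarrow> f n (ampl s * \<beta> * ampl t) = s * f n \<beta> * t"
  using assms by (auto simp: fam_A_def)

lemma fam_one_in_A: "fam_one \<in> fam_A"
proof -
  have "analytic_level n (fam_one n)" for n
    by (auto simp: analytic_level_def fam_one_def)
  moreover have "fam_one (m + n) (mat_dsum \<beta> \<beta>') = mat_dsum (fam_one m \<beta>) (fam_one n \<beta>')"
    if "\<beta> \<in> carrier_mat m m" "\<beta>' \<in> carrier_mat n n" for m n and \<beta> \<beta>' :: "'a mat"
    using that mat_dsum_carrier[OF that] by (simp add: fam_one_def mat_dsum_def)
  moreover have "fam_one n (ampl s * \<beta> * ampl t) = s * fam_one n \<beta> * t"
    if "\<beta> \<in> carrier_mat n n" "s \<in> carrier_mat n n" "t \<in> carrier_mat n n" "s * t = 1\<^sub>m n"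
    for n s t and \<beta> :: "'a mat"
    using that ampl_conj_carrier[OF that(1-3)] by (simp add: fam_one_def)
  ultimately show ?thesis
    unfolding fam_A_def by (auto simp: fam_one_def)
qed

lemma fam_add_in_A:
  assumes f: "f \<in> fam_A" and g: "g \<in> fam_A"
  shows "fam_add f g \<in> fam_A"
proof -
  note F = fam_AD[OF f] and G = fam_AD[OF g]
  have dims [simp]: "dim_row (f n \<beta>) = n" "dim_col (f n \<beta>) = n"
    "dim_row (g n \<beta>) = n" "dim_col (g n \<beta>) = n" for n \<beta>
    using F(1)[of n \<beta>] G(1)[of n \<beta>] by auto
  have "analytic_level n (fam_add f g n)" for n
    using F(3)[of n] G(3)[of n]
    by (auto simp: analytic_level_def fam_add_def intro!: continuous_intros analytic_intros)
  moreover have "fam_add f g (m + n) (mat_dsum \<beta> \<beta>') =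
      mat_dsum (fam_add f g m \<beta>) (fam_add f g n \<beta>')"
    if "\<beta> \<in> carrier_mat m m" "\<beta>' \<in> carrier_mat n n" for m n \<beta> \<beta>'
    unfolding fam_add_def F(4)[OF that] G(4)[OF that]
    by (intro eq_matI) (auto simp: mat_dsum_def)
  moreover have "fam_add f g n (ampl s * \<beta> * ampl t) = s * fam_add f g n \<beta> * t"
    if "\<beta> \<in> carrier_mat n n" "s \<in> carrier_mat n n" "t \<in> carrier_mat n n"
      "s * t = 1\<^sub>m n" "t * s = 1\<^sub>m n" for n s t \<beta>
    unfolding fam_add_def F(5)[OF that] G(5)[OF that]
    using that F(1)[of n \<beta>] G(1)[of n \<beta>]
    by (simp add: add_mult_distrib_mat[of _ n n] mult_add_distrib_mat[of _ n n _ n])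
  ultimately show ?thesis
    unfolding fam_A_def using F(1,2) G(1,2) by (auto simp: fam_add_def)
qed

lemma fam_scale_in_A:
  assumes f: "f \<in> fam_A"
  shows "fam_scale c f \<in> fam_A"
proof -
  note F = fam_AD[OF f]
  have dims [simp]: "dim_row (f n \<beta>) = n" "dim_col (f n \<beta>) = n" for n \<beta>
    using F(1)[of n \<beta>] by auto
  have "analytic_level n (fam_scale c f n)" for n
    using F(3)[of n]
    by (auto simp: analytic_level_def fam_scale_def intro!: continuous_intros analytic_intros)
  moreover have "fam_scale c f (m + n) (mat_dsum \<beta> \<beta>') =
      mat_dsum (fam_scale c f m \<beta>) (fam_scale c f n \<beta>')"
    if "\<beta> \<in> carrier_mat m m" "\<beta>' \<in> carrier_mat n n" for m n \<beta> \<beta>'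
    unfolding fam_scale_def F(4)[OF that]
    by (intro eq_matI) (auto simp: mat_dsum_def)
  moreover have "fam_scale c f n (ampl s * \<beta> * ampl t) = s * fam_scale c f n \<beta> * t"
    if "\<beta> \<in> carrier_mat n n" "s \<in> carrier_mat n n" "t \<in> carrier_mat n n"
      "s * t = 1\<^sub>m n" "t * s = 1\<^sub>m n" for n s t \<beta>
    unfolding fam_scale_def F(5)[OF that]
    using that F(1)[of n \<beta>]
    by (simp add: mult_smult_assoc_mat[of _ n n] mult_smult_distrib[of _ n n])
  ultimately show ?thesis
    unfolding fam_A_def using F(1,2) by (auto simp: fam_scale_def)
qed

lemma fam_mult_in_A:
  assumes f: "f \<in> fam_A" and g: "g \<in> fam_A"
  shows "fam_mult f g \<in> fam_A"
proof -
  note F = fam_AD[OF f] and G = fam_AD[OF g]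
  have dims [simp]: "dim_row (f n \<beta>) = n" "dim_col (f n \<beta>) = n"
    "dim_row (g n \<beta>) = n" "dim_col (g n \<beta>) = n" for n \<beta>
    using F(1)[of n \<beta>] G(1)[of n \<beta>] by auto
  have entry: "fam_mult f g n \<beta> $$ (i, j) = (\<Sum>k<n. f n \<beta> $$ (i, k) * g n \<beta> $$ (k, j))"
    if "i < n" "j < n" for n \<beta> i j
    unfolding fam_mult_def using that F(1) G(1) by (intro mult_entry) auto
  have "analytic_level n (fam_mult f g n)" for n
    using F(3)[of n] G(3)[of n]
    by (auto simp: analytic_level_def entry intro!: continuous_intros analytic_intros)
  moreover have "fam_mult f g (m + n) (mat_dsum \<beta> \<beta>') =
      mat_dsum (fam_mult f g m \<beta>) (fam_mult f g n \<beta>')"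
    if "\<beta> \<in> carrier_mat m m" "\<beta>' \<in> carrier_mat n n" for m n \<beta> \<beta>'
  proof -
    have *: "A * C \<in> carrier_mat m m" "B * D \<in> carrier_mat n n"
      "mat_dsum A B * mat_dsum C D = mat_dsum (A * C) (B * D)"
      if c: "A \<in> carrier_mat m m" "B \<in> carrier_mat n n" "C \<in> carrier_mat m m" "D \<in> carrier_mat n n"
      for A B C D :: "complex mat"
    proof -
      show cc: "A * C \<in> carrier_mat m m" "B * D \<in> carrier_mat n n"
        using c by auto
      have "mat_dsum A B * mat_dsum C D =
          four_block_mat A (0\<^sub>m m n) (0\<^sub>m n m) B * four_block_mat C (0\<^sub>m m n) (0\<^sub>m n m) D"
        using c by (auto simp: mat_dsum_def)
      also have "\<dots> = four_block_mat (A * C + 0\<^sub>m m n * 0\<^sub>m n m) (A * 0\<^sub>m m n + 0\<^sub>m m n * D)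
          (0\<^sub>m n m * C + B * 0\<^sub>m n m) (0\<^sub>m n m * 0\<^sub>m m n + B * D)"
        by (rule mult_four_block_mat[OF c(1) _ _ c(2) c(3) _ _ c(4)]) auto
      also have "\<dots> = mat_dsum (A * C) (B * D)"
        using c cc by (simp add: mat_dsum_def)
      finally show "mat_dsum A B * mat_dsum C D = mat_dsum (A * C) (B * D)" .
    qed
    have "mat_dsum (f m \<beta>) (f n \<beta>') * mat_dsum (g m \<beta>) (g n \<beta>') =
        mat_dsum (f m \<beta> * g m \<beta>) (f n \<beta>' * g n \<beta>')"
      by (rule *(3)[OF F(1) F(1) G(1) G(1)])
    then show ?thesis
      unfolding fam_mult_def F(4)[OF that] G(4)[OF that] .
  qed
  moreover have "fam_mult f g n (ampl s * \<beta> * ampl t) = s * fam_mult f g n \<beta> * t"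
    if st: "\<beta> \<in> carrier_mat n n" "s \<in> carrier_mat n n" "t \<in> carrier_mat n n"
      "s * t = 1\<^sub>m n" "t * s = 1\<^sub>m n" for n s t \<beta>
  proof -
    let ?A = "f n \<beta>" and ?B = "g n \<beta>"
    have AB: "?A \<in> carrier_mat n n" "?B \<in> carrier_mat n n" using F(1) G(1) by auto
    have BT: "?B * t \<in> carrier_mat n n" and SA: "s * ?A \<in> carrier_mat n n"
      and SBT: "s * (?B * t) \<in> carrier_mat n n"
      using AB st by auto
    have "(s * ?A * t) * (s * ?B * t) = (s * ?A * t) * (s * (?B * t))"
      by (simp only: assoc_mult_mat[OF st(2) AB(2) st(3)])
    also have "\<dots> = s * ?A * (t * (s * (?B * t)))"
      by (rule assoc_mult_mat[OF SA st(3) SBT])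
    also have "t * (s * (?B * t)) = (t * s) * (?B * t)"
      by (rule assoc_mult_mat[OF st(3,2) BT, symmetric])
    also have "\<dots> = ?B * t"
      unfolding st(5) using BT by (rule left_mult_one_mat)
    also have "s * ?A * (?B * t) = s * ?A * ?B * t"
      by (rule assoc_mult_mat[OF SA AB(2) st(3), symmetric])
    also have "s * ?A * ?B = s * (?A * ?B)"
      by (rule assoc_mult_mat[OF st(2) AB])
    finally show ?thesis
      unfolding fam_mult_def F(5)[OF st] G(5)[OF st] .
  qed
  moreover have "fam_mult f g n \<beta> \<in> carrier_mat n n" for n \<beta>
    by (rule carrier_matI) (simp_all add: fam_mult_def)
  moreover have "fam_mult f g n \<beta> = 0\<^sub>m n n" if "\<beta> \<notin> carrier_mat n n" for n \<beta>
    unfolding fam_mult_def F(2)[OF that] G(2)[OF that] by simp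
  ultimately show ?thesis
    unfolding fam_A_def by (intro CollectI conjI allI ballI impI) simp_all
qed

lemma unital_subalgebra_fam_A: "unital_subalgebra fam_A"
  unfolding unital_subalgebra_def
  using fam_one_in_A fam_add_in_A fam_mult_in_A fam_scale_in_A by blast

lemma fam_Z_subset_A: "fam_Z \<subseteq> fam_A"
  unfolding fam_Z_def
  by (rule hull_minimal) (auto simp: fam_z_in_A unital_subalgebra_fam_A)

lemma unital_subalgebra_fam_Z: "unital_subalgebra fam_Z"
  unfolding unital_subalgebra_def
proof (intro conjI ballI allI)
  show "fam_Z \<subseteq> fam_A" by (rule fam_Z_subset_A)
  show "fam_one \<in> fam_Z"
    by (simp add: fam_Z_def hull_def unital_subalgebra_def)
  show "fam_add f g \<in> fam_Z" "fam_mult f g \<in> fam_Z" if "f \<in> fam_Z" "g \<in> fam_Z" for f g :: "'a fam"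
    using that by (simp_all add: fam_Z_def hull_def unital_subalgebra_def)
  show "fam_scale c f \<in> fam_Z" if "f \<in> fam_Z" for c and f :: "'a fam"
    using that by (simp add: fam_Z_def hull_def unital_subalgebra_def)
qed

lemma fam_z_in_Z: "\<phi> \<in> top_dual \<Longrightarrow> fam_z \<phi> \<in> fam_Z"
  unfolding fam_Z_def by (rule hull_inc) (rule imageI)

subsection \<open>The difference quotient on a generator\<close>

lemma del_fam_z:
  assumes "\<phi> \<in> top_dual"
  shows "del (fam_z \<phi>) = (\<lambda>m n \<beta> \<beta>' u v. \<phi> 1 * (fam_one \<otimes>\<^sub>f fam_one) m n \<beta> \<beta>' u v)"
proof -
  have "del (fam_z \<phi>) m n \<beta> \<beta>' (a, b) (c, d) =
      \<phi> 1 * (fam_one \<otimes>\<^sub>f fam_one) m n \<beta> \<beta>' (a, b) (c, d)" for m n \<beta> \<beta>' a b c d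
  proof (cases "\<beta> \<in> carrier_mat m m \<and> \<beta>' \<in> carrier_mat n n \<and> a < m \<and> b < m \<and> c < n \<and> d < n")
    case True
    have "fam_z \<phi> (m + n) (four_block_mat \<beta> (scaled_unit m n b c \<epsilon>) (0\<^sub>m n m) \<beta>') $$ (a, m + d)
        = \<epsilon> * (if a = b \<and> c = d then \<phi> 1 else 0)" for \<epsilon>
      using True by (auto simp: fam_z_def scaled_unit_def top_dualD[OF assms])
    then have "del (fam_z \<phi>) m n \<beta> \<beta>' (a, b) (c, d) =
        deriv (\<lambda>\<epsilon>. \<epsilon> * (if a = b \<and> c = d then \<phi> 1 else 0)) 0"
      using True by (simp add: del_def)
    also have "\<dots> = (if a = b \<and> c = d then \<phi> 1 else 0)"
      by (rule DERIV_imp_deriv) (auto intro!: derivative_eq_intros)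
    finally show ?thesis
      using True by (auto simp: tensor_def coeff_mat_def fam_one_def)
  next
    case False
    then show ?thesis by (auto simp: del_def tensor_def coeff_mat_def fam_one_def)
  qed
  then show ?thesis by (intro ext) (auto simp: split_paired_all)
qed

subsection \<open>Independence of the decomposition\<close>

lemma tensor_lift_eqI:
  assumes inv: "\<And>k f g. (\<And>i. i < (k::nat) \<Longrightarrow> f i \<in> fam_Z \<and> g i \<in> fam_Z) \<Longrightarrow>
      (\<Sum>i<k. \<Phi> (f i) (g i)) = G (\<Sum>i<k. f i \<otimes>\<^sub>f g i)"
    and "\<And>i. i < (k::nat) \<Longrightarrow> f i \<in> fam_Z \<and> g i \<in> fam_Z"
  shows "tensor_lift \<Phi> (\<Sum>i<k. f i \<otimes>\<^sub>f g i) = (\<Sum>i<k. \<Phi> (f i) (g i))"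
  unfolding tensor_lift_def
proof (rule the_equality)
  show "\<exists>(k'::nat) f' g'. (\<forall>i<k'. f' i \<in> fam_Z \<and> g' i \<in> fam_Z) \<and>
      (\<Sum>i<k. f i \<otimes>\<^sub>f g i) = (\<Sum>i<k'. f' i \<otimes>\<^sub>f g' i) \<and>
      (\<Sum>i<k. \<Phi> (f i) (g i)) = (\<Sum>i<k'. \<Phi> (f' i) (g' i))"
    using assms(2) by (intro exI[of _ k] exI[of _ f] exI[of _ g]) auto
next
  fix \<eta>
  assume "\<exists>(k'::nat) f' g'. (\<forall>i<k'. f' i \<in> fam_Z \<and> g' i \<in> fam_Z) \<and>
      (\<Sum>i<k. f i \<otimes>\<^sub>f g i) = (\<Sum>i<k'. f' i \<otimes>\<^sub>f g' i) \<and> \<eta> = (\<Sum>i<k'. \<Phi> (f' i) (g' i))"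
  then obtain k' :: nat and f' g' where "\<And>i. i < k' \<Longrightarrow> f' i \<in> fam_Z \<and> g' i \<in> fam_Z"
    "(\<Sum>i<k. f i \<otimes>\<^sub>f g i) = (\<Sum>i<k'. f' i \<otimes>\<^sub>f g' i)" "\<eta> = (\<Sum>i<k'. \<Phi> (f' i) (g' i))"
    by blast
  note rep = this
  have "(\<Sum>i<k. \<Phi> (f i) (g i)) = G (\<Sum>i<k. f i \<otimes>\<^sub>f g i)"
    by (rule inv[OF assms(2)])
  moreover have "\<eta> = G (\<Sum>i<k'. f' i \<otimes>\<^sub>f g' i)"
    unfolding rep(3) by (rule inv[OF rep(1)])
  ultimately show "\<eta> = (\<Sum>i<k. \<Phi> (f i) (g i))"
    by (simp only: rep(2))
qed

lemma sum_fun_apply: "(\<Sum>i\<in>I. F i) x = (\<Sum>i\<in>I. F i x)"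
  by (induction I rule: infinite_finite_induct) auto

lemma block_line:
  fixes \<beta> \<beta>' :: "'b::complex_unital_banach_algebra mat"
  assumes "\<beta> \<in> carrier_mat m m" "\<beta>' \<in> carrier_mat n n"
  shows "four_block_mat \<beta> (scaled_unit m n b c \<epsilon>) (0\<^sub>m n m) \<beta>' =
    four_block_mat \<beta> (0\<^sub>m m n) (0\<^sub>m n m) \<beta>' + map_mat (scaleC \<epsilon>)
      (four_block_mat (0\<^sub>m m m) (scaled_unit m n b c 1) (0\<^sub>m n m) (0\<^sub>m n n))"
  using assms by (intro eq_matI) (auto simp: scaled_unit_def scaleC_scaleC)

lemma fam_A_differentiable:
  assumes "f \<in> fam_A" "\<beta> \<in> carrier_mat m m" "\<beta>' \<in> carrier_mat n n" "i < m + n" "j < m + n"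
  shows "(\<lambda>\<epsilon>. f (m + n) (four_block_mat \<beta> (scaled_unit m n b c \<epsilon>) (0\<^sub>m n m) \<beta>') $$ (i, j))
    field_differentiable at 0"
proof -
  have car: "four_block_mat \<beta> (0\<^sub>m m n) (0\<^sub>m n m) \<beta>' \<in> carrier_mat (m + n) (m + n)"
    "four_block_mat (0\<^sub>m m m) (scaled_unit m n b c 1) (0\<^sub>m n m) (0\<^sub>m n n) \<in> carrier_mat (m + n) (m + n)"
    using assms by auto
  have "(\<lambda>\<epsilon>. f (m + n) (four_block_mat \<beta> (scaled_unit m n b c \<epsilon>) (0\<^sub>m n m) \<beta>') $$ (i, j))
      analytic_on UNIV"
    unfolding block_line[OF assms(2,3)]
    using fam_AD(3)[OF assms(1), of "m + n"] car assms(4,5) unfolding analytic_level_def by blast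
  then show ?thesis
    by (meson UNIV_I analytic_on_imp_differentiable_at)
qed

lemma fam_Z_differentiable:
  assumes "f \<in> fam_Z" "\<beta> \<in> carrier_mat m m" "\<beta>' \<in> carrier_mat n n" "i < m + n" "j < m + n"
  shows "(\<lambda>\<epsilon>. f (m + n) (four_block_mat \<beta> (scaled_unit m n b c \<epsilon>) (0\<^sub>m n m) \<beta>') $$ (i, j))
    field_differentiable at 0"
  using assms fam_Z_subset_A by (intro fam_A_differentiable) auto

lemma fam_Z_carrier: "f \<in> fam_Z \<Longrightarrow> f n \<beta> \<in> carrier_mat n n"
  using fam_Z_subset_A fam_AD(1) by blast

lemma coeff_mat_fam_Z:
  "f \<in> fam_Z \<Longrightarrow> i < n \<Longrightarrow> j < n \<Longrightarrow> coeff_mat (f n \<beta>) (i, j) = f n \<beta> $$ (i, j)"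
  using fam_Z_carrier[of f n \<beta>] by (auto simp: coeff_mat_def)

text \<open>
  \<open>pdel1\<close> and \<open>pdel2\<close> apply the difference quotient to one variable of a two-variable family with
  the other variable fixed. They serve only to see that the values of the lifted maps depend on the
  two-variable family alone and not on a chosen decomposition.
\<close>

definition pdel1 :: "'b::complex_unital_banach_algebra fam2 \<Rightarrow> 'b fam3" where
  "pdel1 \<xi> = (\<lambda>m n p \<beta> \<beta>' \<beta>'' (a, b) (c, d) w.
     if \<beta> \<in> carrier_mat m m \<and> \<beta>' \<in> carrier_mat n n \<and> a < m \<and> b < m \<and> c < n \<and> d < n
     then deriv (\<lambda>\<epsilon>. \<xi> (m + n) p
            (four_block_mat \<beta> (scaled_unit m n b c \<epsilon>) (0\<^sub>m n m) \<beta>') \<beta>'' (a, m + d) w) 0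
     else 0)"

definition pdel2 :: "'b::complex_unital_banach_algebra fam2 \<Rightarrow> 'b fam3" where
  "pdel2 \<xi> = (\<lambda>p m n \<beta>'' \<beta> \<beta>' w (a, b) (c, d).
     if \<beta> \<in> carrier_mat m m \<and> \<beta>' \<in> carrier_mat n n \<and> a < m \<and> b < m \<and> c < n \<and> d < n
     then deriv (\<lambda>\<epsilon>. \<xi> p (m + n) \<beta>''
            (four_block_mat \<beta> (scaled_unit m n b c \<epsilon>) (0\<^sub>m n m) \<beta>') w (a, m + d)) 0
     else 0)"

lemma sum_tensor21_del:
  assumes "\<And>i. i < (k::nat) \<Longrightarrow> f i \<in> fam_Z \<and> g i \<in> fam_Z"
  shows "(\<Sum>i<k. tensor21 (del (f i)) (g i)) = pdel1 (\<Sum>i<k. f i \<otimes>\<^sub>f g i)"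
proof -
  have "(\<Sum>i<k. tensor21 (del (f i)) (g i)) m n p \<beta> \<beta>' \<beta>'' (a, b) (c, d) w =
      pdel1 (\<Sum>i<k. f i \<otimes>\<^sub>f g i) m n p \<beta> \<beta>' \<beta>'' (a, b) (c, d) w" for m n p \<beta> \<beta>' \<beta>'' a b c d w
  proof (cases "\<beta> \<in> carrier_mat m m \<and> \<beta>' \<in> carrier_mat n n \<and> a < m \<and> b < m \<and> c < n \<and> d < n")
    case True
    let ?e = "\<lambda>i \<epsilon>. f i (m + n) (four_block_mat \<beta> (scaled_unit m n b c \<epsilon>) (0\<^sub>m n m) \<beta>') $$ (a, m + d)"
    let ?c = "\<lambda>i. coeff_mat (g i p \<beta>'') w"
    have d: "?e i field_differentiable at 0" if "i < k" for i
      using True assms[OF that] by (intro fam_Z_differentiable) auto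
    have "pdel1 (\<Sum>i<k. f i \<otimes>\<^sub>f g i) m n p \<beta> \<beta>' \<beta>'' (a, b) (c, d) w =
        deriv (\<lambda>\<epsilon>. \<Sum>i<k. ?e i \<epsilon> * ?c i) 0"
      using True assms by (simp add: pdel1_def sum_fun_apply tensor_def coeff_mat_fam_Z)
    also have "\<dots> = (\<Sum>i<k. deriv (?e i) 0 * ?c i)"
      using d by (intro DERIV_imp_deriv DERIV_sum DERIV_cmult_right) (simp add: field_differentiable_derivI)
    finally show ?thesis
      using True by (simp add: sum_fun_apply tensor21_def del_def)
  next
    case False
    then have "del h m n \<beta> \<beta>' (a, b) (c, d) = 0" for h by (auto simp: del_def)
    moreover have "pdel1 h m n p \<beta> \<beta>' \<beta>'' (a, b) (c, d) w = 0" for h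
      using False by (auto simp: pdel1_def)
    ultimately show ?thesis by (simp add: sum_fun_apply tensor21_def)
  qed
  then show ?thesis by (intro ext) (auto simp: split_paired_all)
qed

lemma sum_tensor12_del:
  assumes "\<And>i. i < (k::nat) \<Longrightarrow> f i \<in> fam_Z \<and> g i \<in> fam_Z"
  shows "(\<Sum>i<k. tensor12 (f i) (del (g i))) = pdel2 (\<Sum>i<k. f i \<otimes>\<^sub>f g i)"
proof -
  have "(\<Sum>i<k. tensor12 (f i) (del (g i))) p m n \<beta>'' \<beta> \<beta>' w (a, b) (c, d) =
      pdel2 (\<Sum>i<k. f i \<otimes>\<^sub>f g i) p m n \<beta>'' \<beta> \<beta>' w (a, b) (c, d)" for m n p \<beta> \<beta>' \<beta>'' a b c d w
  proof (cases "\<beta> \<in> carrier_mat m m \<and> \<beta>' \<in> carrier_mat n n \<and> a < m \<and> b < m \<and> c < n \<and> d < n")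
    case True
    let ?e = "\<lambda>i \<epsilon>. g i (m + n) (four_block_mat \<beta> (scaled_unit m n b c \<epsilon>) (0\<^sub>m n m) \<beta>') $$ (a, m + d)"
    let ?c = "\<lambda>i. coeff_mat (f i p \<beta>'') w"
    have d: "?e i field_differentiable at 0" if "i < k" for i
      using True assms[OF that] by (intro fam_Z_differentiable) auto
    have "pdel2 (\<Sum>i<k. f i \<otimes>\<^sub>f g i) p m n \<beta>'' \<beta> \<beta>' w (a, b) (c, d) =
        deriv (\<lambda>\<epsilon>. \<Sum>i<k. ?c i * ?e i \<epsilon>) 0"
      using True assms by (simp add: pdel2_def sum_fun_apply tensor_def coeff_mat_fam_Z)
    also have "\<dots> = (\<Sum>i<k. ?c i * deriv (?e i) 0)"
      using d by (intro DERIV_imp_deriv DERIV_sum DERIV_cmult) (simp add: field_differentiable_derivI)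
    finally show ?thesis
      using True by (simp add: sum_fun_apply tensor12_def del_def)
  next
    case False
    then have "del h m n \<beta> \<beta>' (a, b) (c, d) = 0" for h by (auto simp: del_def)
    moreover have "pdel2 h p m n \<beta>'' \<beta> \<beta>' w (a, b) (c, d) = 0" for h
      using False by (auto simp: pdel2_def)
    ultimately show ?thesis by (simp add: sum_fun_apply tensor12_def)
  qed
  note eq = this
  show ?thesis
  proof (intro ext)
    fix p m n \<beta>'' \<beta> \<beta>' w and u v :: "nat \<times> nat"
    show "(\<Sum>i<k. tensor12 (f i) (del (g i))) p m n \<beta>'' \<beta> \<beta>' w u v =
        pdel2 (\<Sum>i<k. f i \<otimes>\<^sub>f g i) p m n \<beta>'' \<beta> \<beta>' w u v"
      by (cases u; cases v) (simp only: eq)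
  qed
qed

lemma del_id_sum:
  assumes "\<And>i. i < (k::nat) \<Longrightarrow> f i \<in> fam_Z \<and> g i \<in> fam_Z"
  shows "del_id (\<Sum>i<k. f i \<otimes>\<^sub>f g i) = (\<Sum>i<k. tensor21 (del (f i)) (g i))"
  unfolding del_id_def
  by (rule tensor_lift_eqI[where G = pdel1, OF sum_tensor21_del assms])

lemma id_del_sum:
  assumes "\<And>i. i < (k::nat) \<Longrightarrow> f i \<in> fam_Z \<and> g i \<in> fam_Z"
  shows "id_del (\<Sum>i<k. f i \<otimes>\<^sub>f g i) = (\<Sum>i<k. tensor12 (f i) (del (g i)))"
  unfolding id_del_def
  by (rule tensor_lift_eqI[where G = pdel2, OF sum_tensor12_del assms])

lemma coeff_mat_sharp:
  "coeff_mat (sharp n t x) (i, j) =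
    (if i < n \<and> j < n then \<Sum>k<n. \<Sum>l<n. t (i, k) (l, j) * x $$ (k, l) else 0)"
  by (simp add: coeff_mat_def sharp_def)

lemma num_op_id_sum:
  assumes "\<And>i. i < (k::nat) \<Longrightarrow> f i \<in> fam_Z \<and> g i \<in> fam_Z"
  shows "tensor_lift (\<lambda>f g. num_op \<theta> f \<otimes>\<^sub>f g) (\<Sum>i<k. f i \<otimes>\<^sub>f g i) = (\<Sum>i<k. num_op \<theta> (f i) \<otimes>\<^sub>f g i)"
proof -
  let ?G = "\<lambda>\<xi> n p \<beta> \<beta>'' (i, j) w. if i < n \<and> j < n then
      \<Sum>r<n. \<Sum>l<n. pdel1 \<xi> n n p \<beta> \<beta> \<beta>'' (i, r) (l, j) w * fam_z \<theta> n \<beta> $$ (r, l) else 0"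
  have "(\<Sum>i<k. num_op \<theta> (f i) \<otimes>\<^sub>f g i) = ?G (\<Sum>i<k. f i \<otimes>\<^sub>f g i)"
    if "\<And>i. i < k \<Longrightarrow> f i \<in> fam_Z \<and> g i \<in> fam_Z" for k :: nat and f g
  proof -
    have *: "pdel1 (\<Sum>i<k. f i \<otimes>\<^sub>f g i) = (\<Sum>i<k. tensor21 (del (f i)) (g i))"
      using sum_tensor21_del[of k f g] that by simp
    have "(\<Sum>q<k. num_op \<theta> (f q) \<otimes>\<^sub>f g q) n p \<beta> \<beta>'' (i, j) w =
        ?G (\<Sum>i<k. f i \<otimes>\<^sub>f g i) n p \<beta> \<beta>'' (i, j) w" for n p \<beta> \<beta>'' i j w
    proof (cases "i < n \<and> j < n")
      case True
      have "(\<Sum>q<k. num_op \<theta> (f q) \<otimes>\<^sub>f g q) n p \<beta> \<beta>'' (i, j) w =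
        (\<Sum>q<k. \<Sum>r<n. \<Sum>l<n. del (f q) n n \<beta> \<beta> (i, r) (l, j) * coeff_mat (g q p \<beta>'') w * fam_z \<theta> n \<beta> $$ (r, l))"
        using True by (simp add: sum_fun_apply tensor_def num_op_def del_star_def coeff_mat_sharp
            sum_distrib_right sum_distrib_left mult_ac)
      also have "\<dots> = (\<Sum>r<n. \<Sum>q<k. \<Sum>l<n. del (f q) n n \<beta> \<beta> (i, r) (l, j) * coeff_mat (g q p \<beta>'') w * fam_z \<theta> n \<beta> $$ (r, l))"
        by (rule sum.swap)
      also have "\<dots> = (\<Sum>r<n. \<Sum>l<n. \<Sum>q<k. del (f q) n n \<beta> \<beta> (i, r) (l, j) * coeff_mat (g q p \<beta>'') w * fam_z \<theta> n \<beta> $$ (r, l))"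
        by (rule sum.cong[OF refl], rule sum.swap)
      finally show ?thesis
        using True by (simp add: * sum_fun_apply tensor21_def sum_distrib_right)
    next
      case False
      then show ?thesis
        by (auto simp: sum_fun_apply tensor_def num_op_def del_star_def coeff_mat_sharp)
    qed
    note eq = this
    show ?thesis
    proof (intro ext)
      fix n p \<beta> \<beta>'' w and u :: "nat \<times> nat"
      show "(\<Sum>q<k. num_op \<theta> (f q) \<otimes>\<^sub>f g q) n p \<beta> \<beta>'' u w = ?G (\<Sum>i<k. f i \<otimes>\<^sub>f g i) n p \<beta> \<beta>'' u w"
        by (cases u) (simp only: eq)
    qed
  qed
  note eq = this
  show ?thesis
    by (rule tensor_lift_eqI[where G = ?G, OF eq assms])
qed

lemma id_num_op_sum:
  assumes "\<And>i. i < (k::nat) \<Longrightarrow> f i \<in> fam_Z \<and> g i \<in> fam_Z"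
  shows "tensor_lift (\<lambda>f g. f \<otimes>\<^sub>f num_op \<theta> g) (\<Sum>i<k. f i \<otimes>\<^sub>f g i) = (\<Sum>i<k. f i \<otimes>\<^sub>f num_op \<theta> (g i))"
proof -
  let ?G = "\<lambda>\<xi> p n \<beta>'' \<beta> w (i, j). if i < n \<and> j < n then
      \<Sum>r<n. \<Sum>l<n. pdel2 \<xi> p n n \<beta>'' \<beta> \<beta> w (i, r) (l, j) * fam_z \<theta> n \<beta> $$ (r, l) else 0"
  have "(\<Sum>i<k. f i \<otimes>\<^sub>f num_op \<theta> (g i)) = ?G (\<Sum>i<k. f i \<otimes>\<^sub>f g i)"
    if "\<And>i. i < k \<Longrightarrow> f i \<in> fam_Z \<and> g i \<in> fam_Z" for k :: nat and f g
  proof -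
    have *: "pdel2 (\<Sum>i<k. f i \<otimes>\<^sub>f g i) = (\<Sum>i<k. tensor12 (f i) (del (g i)))"
      using sum_tensor12_del[of k f g] that by simp
    have "(\<Sum>q<k. f q \<otimes>\<^sub>f num_op \<theta> (g q)) p n \<beta>'' \<beta> w (i, j) =
        ?G (\<Sum>i<k. f i \<otimes>\<^sub>f g i) p n \<beta>'' \<beta> w (i, j)" for n p \<beta> \<beta>'' i j w
    proof (cases "i < n \<and> j < n")
      case True
      have "(\<Sum>q<k. f q \<otimes>\<^sub>f num_op \<theta> (g q)) p n \<beta>'' \<beta> w (i, j) =
        (\<Sum>q<k. \<Sum>r<n. \<Sum>l<n. coeff_mat (f q p \<beta>'') w * del (g q) n n \<beta> \<beta> (i, r) (l, j) * fam_z \<theta> n \<beta> $$ (r, l))"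
        using True by (simp add: sum_fun_apply tensor_def num_op_def del_star_def coeff_mat_sharp
            sum_distrib_left mult_ac)
      also have "\<dots> = (\<Sum>r<n. \<Sum>q<k. \<Sum>l<n. coeff_mat (f q p \<beta>'') w * del (g q) n n \<beta> \<beta> (i, r) (l, j) * fam_z \<theta> n \<beta> $$ (r, l))"
        by (rule sum.swap)
      also have "\<dots> = (\<Sum>r<n. \<Sum>l<n. \<Sum>q<k. coeff_mat (f q p \<beta>'') w * del (g q) n n \<beta> \<beta> (i, r) (l, j) * fam_z \<theta> n \<beta> $$ (r, l))"
        by (rule sum.cong[OF refl], rule sum.swap)
      finally show ?thesis
        using True by (simp add: * sum_fun_apply tensor12_def sum_distrib_right)
    next
      case False
      then show ?thesis
        by (auto simp: sum_fun_apply tensor_def num_op_def del_star_def coeff_mat_sharp)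
    qed
    note eq = this
    show ?thesis
    proof (intro ext)
      fix p n \<beta>'' \<beta> w and u :: "nat \<times> nat"
      show "(\<Sum>q<k. f q \<otimes>\<^sub>f num_op \<theta> (g q)) p n \<beta>'' \<beta> w u = ?G (\<Sum>i<k. f i \<otimes>\<^sub>f g i) p n \<beta>'' \<beta> w u"
        by (cases u) (simp only: eq)
    qed
  qed
  note eq = this
  show ?thesis
    by (rule tensor_lift_eqI[where G = ?G, OF eq assms])
qed

end

theory Submission
  imports Defs
begin

text \<open>
  Write \<open>Z\<close> for the algebra \<open>fam_Z\<close>, \<open>\<partial>\<close> for \<open>del\<close>, \<open>X = z(\<theta>)\<close>, \<open>N\<close> for \<open>num_op \<theta>\<close> and \<open>N\<^sub>2\<close> for
  \<open>num_op2 \<theta>\<close>.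

  A tensor \<open>\<xi>\<close> with \<open>(\<partial> \<otimes> id) \<xi> = (id \<otimes> \<partial>) \<xi>\<close> satisfies \<open>\<partial> \<partial>\<^sub>\<theta>\<^sup>* \<xi> = N\<^sub>2 \<xi>\<close> for a formal
  reason. As \<open>\<theta>(1) = 1\<close>, the Leibniz rule gives, for \<open>\<xi> = \<Sum> f \<otimes> g\<close>,
  \<open>\<partial> \<partial>\<^sub>\<theta>\<^sup>* \<xi> = \<Sum> (\<partial>f (1 \<otimes> X g) + f \<otimes> g + (f X \<otimes> 1) \<partial>g)\<close>.
  Let \<open>C\<^sub>1\<^sub>2\<close> and \<open>C\<^sub>2\<^sub>3\<close> be the contractions \<open>a \<otimes> b \<otimes> c \<mapsto> a X b \<otimes> c\<close> and \<open>a \<otimes> b \<otimes> c \<mapsto> a \<otimes> b X c\<close>.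
  Then the right hand side is \<open>C\<^sub>2\<^sub>3((\<partial> \<otimes> id) \<xi>) + \<xi> + C\<^sub>1\<^sub>2((id \<otimes> \<partial>) \<xi>)\<close> (\<open>del_del_star_contract\<close>),
  whereas \<open>N\<^sub>2 \<xi> = C\<^sub>1\<^sub>2((\<partial> \<otimes> id) \<xi>) + \<xi> + C\<^sub>2\<^sub>3((id \<otimes> \<partial>) \<xi>)\<close> (\<open>num_op2_contract\<close>). The two
  agree as soon as \<open>(\<partial> \<otimes> id) \<xi> = (id \<otimes> \<partial>) \<xi>\<close>, and by coassociativity (\<open>del_coassociative\<close>) this
  holds for \<open>\<xi> = \<partial> q\<close>. In particular \<open>N\<^sub>2 \<partial> = \<partial> N\<close> on \<open>Z\<close>.

  For the way back, \<open>N\<close> is the derivation of \<open>Z\<close> with \<open>N z(\<phi>) = \<phi>(1) X\<close>. As \<open>\<theta>(1) = 1\<close>, every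
  generator is the sum of an element killed by \<open>N\<close> and one fixed by \<open>N\<close>, so \<open>Z\<close> is spanned by
  eigenvectors of \<open>N\<close> with eigenvalues in \<open>\<nat>\<close>. Hence the tensor square is spanned by eigenvectors
  of \<open>N\<^sub>2\<close> with eigenvalues at least 1, and \<open>N\<^sub>2\<close> is bijective there (\<open>num_op2_inj\<close>,
  \<open>num_op2_surj\<close>). Moreover \<open>N \<partial>\<^sub>\<theta>\<^sup>* = \<partial>\<^sub>\<theta>\<^sup>* N\<^sub>2\<close> (\<open>num_op_del_star\<close>). If \<open>\<partial> \<partial>\<^sub>\<theta>\<^sup>* \<xi> = N\<^sub>2 \<xi>\<close>, write
  \<open>\<xi> = N\<^sub>2 \<xi>'\<close> and put \<open>q = \<partial>\<^sub>\<theta>\<^sup>* \<xi>'\<close>. Then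
  \<open>N\<^sub>2 \<partial> q = \<partial> N q = \<partial> \<partial>\<^sub>\<theta>\<^sup>* N\<^sub>2 \<xi>' = \<partial> \<partial>\<^sub>\<theta>\<^sup>* \<xi> = N\<^sub>2 \<xi>\<close>, so \<open>\<partial> q = \<xi>\<close>.

  The freeness of \<open>Z\<close> is not used: induction over the generation of \<open>Z\<close> as an algebra suffices.
\<close>

(* As rewrite rules these also unfold sums and zeros that are not applied to any argument. *)
lemmas [simp del] = plus_fun_apply zero_fun_apply

section \<open>The algebra of noncommutative polynomials\<close>

lemma coeff_mat_mult:
  assumes "A \<in> carrier_mat n n" "B \<in> carrier_mat n n"
  shows "coeff_mat (A * B) (i, j) = (\<Sum>k<n. coeff_mat A (i, k) * coeff_mat B (k, j))"
proof (cases "i < n \<and> j < n")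
  case True
  then show ?thesis
    using assms mult_entry[OF assms, of i j] by (auto simp: coeff_mat_def)
next
  case False
  then have "coeff_mat A (i, k) * coeff_mat B (k, j) = 0" for k
    using assms by (auto simp: coeff_mat_def)
  then show ?thesis
    using False assms by (auto simp: coeff_mat_def)
qed

lemma coeff_mat_add:
  assumes "A \<in> carrier_mat n n" "B \<in> carrier_mat n n"
  shows "coeff_mat (A + B) u = coeff_mat A u + coeff_mat B u"
  using assms by (cases u) (auto simp: coeff_mat_def)

lemma coeff_mat_smult: "coeff_mat (c \<cdot>\<^sub>m A) u = c * coeff_mat A u"
  by (cases u) (auto simp: coeff_mat_def)

lemma coeff_mat_eqI:
  assumes "A \<in> carrier_mat n n" "B \<in> carrier_mat n n"
    and "\<And>i j. i < n \<Longrightarrow> j < n \<Longrightarrow> coeff_mat A (i, j) = coeff_mat B (i, j)"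
  shows "A = B"
  using assms by (intro eq_matI) (auto simp: coeff_mat_def)

lemma coeff_mat_out:
  "A \<in> carrier_mat n n \<Longrightarrow> n \<le> i \<or> n \<le> j \<Longrightarrow> coeff_mat A (i, j) = 0"
  by (auto simp: coeff_mat_def)

lemma fam_Z_one: "fam_one \<in> fam_Z"
  and fam_Z_add: "f \<in> fam_Z \<Longrightarrow> g \<in> fam_Z \<Longrightarrow> fam_add f g \<in> fam_Z"
  and fam_Z_mult: "f \<in> fam_Z \<Longrightarrow> g \<in> fam_Z \<Longrightarrow> fam_mult f g \<in> fam_Z"
  and fam_Z_scale: "f \<in> fam_Z \<Longrightarrow> fam_scale c f \<in> fam_Z"
  using unital_subalgebra_fam_Z by (auto simp: unital_subalgebra_def)

lemma fam_Z_zero_outside: "f \<in> fam_Z \<Longrightarrow> \<beta> \<notin> carrier_mat n n \<Longrightarrow> f n \<beta> = 0\<^sub>m n n"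
  using fam_AD(2) fam_Z_subset_A by blast

lemma coeff_fam_mult:
  assumes "f \<in> fam_Z" "g \<in> fam_Z"
  shows "coeff_mat (fam_mult f g n \<beta>) (i, j) =
    (\<Sum>k<n. coeff_mat (f n \<beta>) (i, k) * coeff_mat (g n \<beta>) (k, j))"
  unfolding fam_mult_def
  by (rule coeff_mat_mult[OF fam_Z_carrier[OF assms(1)] fam_Z_carrier[OF assms(2)]])

lemma coeff_fam_add:
  assumes "f \<in> fam_Z" "g \<in> fam_Z"
  shows "coeff_mat (fam_add f g n \<beta>) u = coeff_mat (f n \<beta>) u + coeff_mat (g n \<beta>) u"
  unfolding fam_add_def
  by (rule coeff_mat_add[OF fam_Z_carrier[OF assms(1)] fam_Z_carrier[OF assms(2)]])

lemma coeff_fam_scale: "coeff_mat (fam_scale c f n \<beta>) u = c * coeff_mat (f n \<beta>) u"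
  by (simp add: fam_scale_def coeff_mat_smult)

lemma fam_Z_eqI:
  assumes "f \<in> fam_Z" "g \<in> fam_Z"
    and "\<And>n \<beta> i j. coeff_mat (f n \<beta>) (i, j) = coeff_mat (g n \<beta>) (i, j)"
  shows "f = g"
  using assms by (intro ext coeff_mat_eqI[OF fam_Z_carrier fam_Z_carrier]) auto

lemma fam_mult_const_left:
  assumes "f \<in> fam_Z"
  shows "fam_mult (fam_scale c fam_one) f = fam_scale c f"
proof (intro ext)
  fix n \<beta>
  show "fam_mult (fam_scale c fam_one) f n \<beta> = fam_scale c f n \<beta>"
  proof (cases "\<beta> \<in> carrier_mat n n")
    case True
    then show ?thesis
      using fam_Z_carrier[OF assms, of n \<beta>]
      by (simp add: fam_mult_def fam_scale_def fam_one_def mult_smult_assoc_mat[of _ n n])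
  next
    case False
    then show ?thesis
      using fam_Z_zero_outside[OF assms False]
      by (simp add: fam_mult_def fam_scale_def fam_one_def)
  qed
qed

lemma fam_scale_one: "fam_scale 1 fam_one = fam_one"
  by (intro ext) (auto simp: fam_scale_def fam_one_def intro!: eq_matI)

text \<open>
  Scalar multiplication is multiplication by a constant family (\<open>fam_mult_const_left\<close>), so the
  induction needs a case for constants but none for scalar multiples.
\<close>

lemma fam_Z_induct [consumes 1, case_names const gen add mult]:
  assumes "f \<in> fam_Z"
    and const: "\<And>c. P (fam_scale c fam_one)"
    and gen: "\<And>\<phi>. \<phi> \<in> top_dual \<Longrightarrow> P (fam_z \<phi>)"
    and add: "\<And>f g. f \<in> fam_Z \<Longrightarrow> g \<in> fam_Z \<Longrightarrow> P f \<Longrightarrow> P g \<Longrightarrow> P (fam_add f g)"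
    and mult: "\<And>f g. f \<in> fam_Z \<Longrightarrow> g \<in> fam_Z \<Longrightarrow> P f \<Longrightarrow> P g \<Longrightarrow> P (fam_mult f g)"
  shows "P f"
proof -
  have scale: "P (fam_scale c f)" if "f \<in> fam_Z" "P f" for c f
    using mult[OF fam_Z_scale[OF fam_Z_one, of c] that(1) const that(2)]
    by (simp add: fam_mult_const_left[OF that(1)])
  have "unital_subalgebra {f \<in> fam_Z. P f}"
    unfolding unital_subalgebra_def
    using fam_Z_subset_A fam_Z_one fam_Z_add fam_Z_mult fam_Z_scale const[of 1] add mult scale
    by (auto simp: fam_scale_one)
  moreover have "fam_z ` top_dual \<subseteq> {f \<in> fam_Z. P f}"
    using gen fam_z_in_Z by auto
  ultimately have "fam_Z \<subseteq> {f \<in> fam_Z. P f}"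
    unfolding fam_Z_def by (rule hull_minimal[rotated])
  then show ?thesis using assms(1) by auto
qed

lemma fam_mult_assoc:
  assumes "f \<in> fam_Z" "g \<in> fam_Z" "h \<in> fam_Z"
  shows "fam_mult (fam_mult f g) h = fam_mult f (fam_mult g h)"
  unfolding fam_mult_def using assms by (intro ext assoc_mult_mat) (rule fam_Z_carrier; assumption)+

lemma fam_mult_add_left:
  assumes "f \<in> fam_Z" "g \<in> fam_Z" "h \<in> fam_Z"
  shows "fam_mult (fam_add f g) h = fam_add (fam_mult f h) (fam_mult g h)"
  unfolding fam_mult_def fam_add_def using assms by (intro ext add_mult_distrib_mat) (rule fam_Z_carrier; assumption)+

lemma fam_mult_add_right:
  assumes "f \<in> fam_Z" "g \<in> fam_Z" "h \<in> fam_Z"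
  shows "fam_mult h (fam_add f g) = fam_add (fam_mult h f) (fam_mult h g)"
  unfolding fam_mult_def fam_add_def using assms by (intro ext mult_add_distrib_mat) (rule fam_Z_carrier; assumption)+

text \<open>
  This is what makes the difference quotient a derivation: in a product of block upper triangular
  matrices only the corner block depends on the perturbation \<open>x\<close>.
\<close>

lemma fam_Z_block_upper_triangular:
  assumes "f \<in> fam_Z" "\<beta> \<in> carrier_mat m m" "x \<in> carrier_mat m n" "\<beta>' \<in> carrier_mat n n"
  shows "\<exists>Y\<in>carrier_mat m n. f (m + n) (four_block_mat \<beta> x (0\<^sub>m n m) \<beta>') =
    four_block_mat (f m \<beta>) Y (0\<^sub>m n m) (f n \<beta>')"
  using assms(1)
proof (induction rule: fam_Z_induct)
  case (const c)
  then show ?case using assms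
    by (intro bexI[of _ "0\<^sub>m m n"] eq_matI) (auto simp: fam_scale_def fam_one_def)
next
  case (gen \<phi>)
  then show ?case using assms
    by (intro bexI[of _ "map_mat \<phi> x"] eq_matI) (auto simp: fam_z_def top_dualD)
next
  case (add f g)
  then obtain Y Y' where Y: "Y \<in> carrier_mat m n" "Y' \<in> carrier_mat m n"
    "f (m + n) (four_block_mat \<beta> x (0\<^sub>m n m) \<beta>') = four_block_mat (f m \<beta>) Y (0\<^sub>m n m) (f n \<beta>')"
    "g (m + n) (four_block_mat \<beta> x (0\<^sub>m n m) \<beta>') = four_block_mat (g m \<beta>) Y' (0\<^sub>m n m) (g n \<beta>')"
    by blast
  note car = fam_Z_carrier[OF add.hyps(1)] fam_Z_carrier[OF add.hyps(2)]
  have dims [simp]: "dim_row (f n \<beta>) = n" "dim_col (f n \<beta>) = n"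
    "dim_row (g n \<beta>) = n" "dim_col (g n \<beta>) = n" for n \<beta>
    using car[of n \<beta>] by auto
  show ?case
    using Y by (intro bexI[of _ "Y + Y'"] eq_matI) (auto simp: fam_add_def)
next
  case (mult f g)
  then obtain Y Y' where Y: "Y \<in> carrier_mat m n" "Y' \<in> carrier_mat m n"
    "f (m + n) (four_block_mat \<beta> x (0\<^sub>m n m) \<beta>') = four_block_mat (f m \<beta>) Y (0\<^sub>m n m) (f n \<beta>')"
    "g (m + n) (four_block_mat \<beta> x (0\<^sub>m n m) \<beta>') = four_block_mat (g m \<beta>) Y' (0\<^sub>m n m) (g n \<beta>')"
    by blast
  note cf = fam_Z_carrier[OF mult.hyps(1)] and cg = fam_Z_carrier[OF mult.hyps(2)]
  have "fam_mult f g (m + n) (four_block_mat \<beta> x (0\<^sub>m n m) \<beta>') =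
      four_block_mat (f m \<beta> * g m \<beta> + Y * 0\<^sub>m n m) (f m \<beta> * Y' + Y * g n \<beta>')
        (0\<^sub>m n m * g m \<beta> + f n \<beta>' * 0\<^sub>m n m) (0\<^sub>m n m * Y' + f n \<beta>' * g n \<beta>')"
    unfolding fam_mult_def Y(3,4)
    by (rule mult_four_block_mat[OF cf Y(1) _ cf cg Y(2) _ cg]) auto
  also have "\<dots> = four_block_mat (fam_mult f g m \<beta>) (f m \<beta> * Y' + Y * g n \<beta>')
      (0\<^sub>m n m) (fam_mult f g n \<beta>')"
  proof -
    have "f m \<beta> * g m \<beta> \<in> carrier_mat m m" "f n \<beta>' * g n \<beta>' \<in> carrier_mat n n"
      using cf cg by (meson mult_carrier_mat)+
    moreover have "Y * 0\<^sub>m n m = 0\<^sub>m m m" "0\<^sub>m n m * Y' = 0\<^sub>m n n"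
      "0\<^sub>m n m * g m \<beta> = 0\<^sub>m n m" "f n \<beta>' * 0\<^sub>m n m = 0\<^sub>m n m"
      using Y(1,2) cf[of n \<beta>'] cg[of m \<beta>] by auto
    ultimately show ?thesis by (simp add: fam_mult_def)
  qed
  finally show ?case
    using cf cg Y(1,2) by (meson add_carrier_mat mult_carrier_mat)
qed


section \<open>The difference quotient as a derivation\<close>

text \<open>
  \<open>rmul2 g \<xi>\<close> is \<open>\<xi> (1 \<otimes> g)\<close> and \<open>lmul2 f \<xi>\<close> is \<open>(f \<otimes> 1) \<xi>\<close>: the outer bimodule structure of the
  tensor square. No index bounds are tested, because coefficients out of range vanish.
\<close>

definition rmul2 :: "'b fam \<Rightarrow> 'b fam2 \<Rightarrow> 'b fam2" where
  "rmul2 g \<xi> = (\<lambda>m n \<beta> \<beta>' u (c, d). \<Sum>k<n. \<xi> m n \<beta> \<beta>' u (c, k) * coeff_mat (g n \<beta>') (k, d))"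

definition lmul2 :: "'b fam \<Rightarrow> 'b fam2 \<Rightarrow> 'b fam2" where
  "lmul2 f \<xi> = (\<lambda>m n \<beta> \<beta>' (a, b) v. \<Sum>k<m. coeff_mat (f m \<beta>) (a, k) * \<xi> m n \<beta> \<beta>' (k, b) v)"

lemma del_out:
  assumes "\<not> (\<beta> \<in> carrier_mat m m \<and> \<beta>' \<in> carrier_mat n n \<and> a < m \<and> b < m \<and> c < n \<and> d < n)"
  shows "del f m n \<beta> \<beta>' (a, b) (c, d) = 0"
  using assms by (auto simp: del_def)

lemma fam2_eqI:
  assumes "\<And>m n \<beta> \<beta>' a b c d. \<xi> m n \<beta> \<beta>' (a, b) (c, d) = \<eta> m n \<beta> \<beta>' (a, b) (c, d)"
  shows "\<xi> = (\<eta> :: 'b fam2)"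
  using assms by (intro ext) (auto simp: split_paired_all)

lemma fam3_eqI:
  assumes "\<And>m n p \<beta> \<beta>' \<beta>'' a b c d e f.
    \<xi> m n p \<beta> \<beta>' \<beta>'' (a, b) (c, d) (e, f) = \<eta> m n p \<beta> \<beta>' \<beta>'' (a, b) (c, d) (e, f)"
  shows "\<xi> = (\<eta> :: 'b fam3)"
  using assms by (intro ext) (auto simp: split_paired_all)

text \<open>The Leibniz rule \<open>\<partial>(f g) = \<partial>f (1 \<otimes> g) + (f \<otimes> 1) \<partial>g\<close>.\<close>

theorem del_mult:
  assumes f: "f \<in> fam_Z" and g: "g \<in> fam_Z"
  shows "del (fam_mult f g) = rmul2 g (del f) + lmul2 f (del g)"
proof (rule fam2_eqI)
  fix m n \<beta> \<beta>' a b c d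
  show "del (fam_mult f g) m n \<beta> \<beta>' (a, b) (c, d) =
    (rmul2 g (del f) + lmul2 f (del g)) m n \<beta> \<beta>' (a, b) (c, d)"
  proof (cases "\<beta> \<in> carrier_mat m m \<and> \<beta>' \<in> carrier_mat n n \<and> a < m \<and> b < m \<and> c < n \<and> d < n")
    case True
    define M where "M \<epsilon> = four_block_mat \<beta> (scaled_unit m n b c \<epsilon>) (0\<^sub>m n m) \<beta>'" for \<epsilon>
    have su: "scaled_unit m n b c \<epsilon> \<in> carrier_mat m n" for \<epsilon>
      by (simp add: scaled_unit_def)
    have entry: "fam_mult f g (m + n) (M \<epsilon>) $$ (a, m + d) =
        (\<Sum>k<n. f (m + n) (M \<epsilon>) $$ (a, m + k) * g n \<beta>' $$ (k, d)) +
        (\<Sum>k<m. f m \<beta> $$ (a, k) * g (m + n) (M \<epsilon>) $$ (k, m + d))" for \<epsilon>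
    proof -
      note cf = fam_Z_carrier[OF f] and cg = fam_Z_carrier[OF g]
      obtain Y Y' where Y: "Y \<in> carrier_mat m n" "Y' \<in> carrier_mat m n"
        "f (m + n) (M \<epsilon>) = four_block_mat (f m \<beta>) Y (0\<^sub>m n m) (f n \<beta>')"
        "g (m + n) (M \<epsilon>) = four_block_mat (g m \<beta>) Y' (0\<^sub>m n m) (g n \<beta>')"
        using fam_Z_block_upper_triangular[OF f _ su] fam_Z_block_upper_triangular[OF g _ su] True
        unfolding M_def by meson
      have dims: "dim_row (f k \<beta>) = k" "dim_col (f k \<beta>) = k"
        "dim_row (g k \<beta>) = k" "dim_col (g k \<beta>) = k" for k \<beta>
        using cf[of k \<beta>] cg[of k \<beta>] by auto
      have "fam_mult f g (m + n) (M \<epsilon>) =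
          four_block_mat (f m \<beta> * g m \<beta> + Y * 0\<^sub>m n m) (f m \<beta> * Y' + Y * g n \<beta>')
            (0\<^sub>m n m * g m \<beta> + f n \<beta>' * 0\<^sub>m n m) (0\<^sub>m n m * Y' + f n \<beta>' * g n \<beta>')"
        unfolding fam_mult_def Y(3,4)
        by (rule mult_four_block_mat[OF cf Y(1) _ cf cg Y(2) _ cg]) auto
      then have "fam_mult f g (m + n) (M \<epsilon>) $$ (a, m + d) =
          (\<Sum>k<m. f m \<beta> $$ (a, k) * Y' $$ (k, d)) + (\<Sum>k<n. Y $$ (a, k) * g n \<beta>' $$ (k, d))"
        using True Y(1,2) by (simp add: dims scalar_prod_def atLeast0LessThan)
      then show ?thesis
        unfolding Y(3,4) using True Y(1,2) by (simp add: dims)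
    qed
    have df: "(\<lambda>\<epsilon>. f (m + n) (M \<epsilon>) $$ (a, m + k)) field_differentiable at 0" if "k < n" for k
      unfolding M_def using True that by (intro fam_Z_differentiable[OF f]) auto
    have dg: "(\<lambda>\<epsilon>. g (m + n) (M \<epsilon>) $$ (k, m + d)) field_differentiable at 0" if "k < m" for k
      unfolding M_def using True that by (intro fam_Z_differentiable[OF g]) auto
    have "((\<lambda>\<epsilon>. fam_mult f g (m + n) (M \<epsilon>) $$ (a, m + d)) has_field_derivative
        (\<Sum>k<n. deriv (\<lambda>\<epsilon>. f (m + n) (M \<epsilon>) $$ (a, m + k)) 0 * g n \<beta>' $$ (k, d)) +
        (\<Sum>k<m. f m \<beta> $$ (a, k) * deriv (\<lambda>\<epsilon>. g (m + n) (M \<epsilon>) $$ (k, m + d)) 0)) (at 0)"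
      unfolding entry
      by (intro DERIV_add DERIV_sum DERIV_cmult DERIV_cmult_right)
        (simp_all add: field_differentiable_derivI df dg)
    then show ?thesis
      using True unfolding M_def
      by (simp add: plus_fun_apply del_def rmul2_def lmul2_def DERIV_imp_deriv coeff_mat_fam_Z f g)
  next
    case False
    have "rmul2 g (del f) m n \<beta> \<beta>' (a, b) (c, d) = 0" "lmul2 f (del g) m n \<beta> \<beta>' (a, b) (c, d) = 0"
      using False fam_Z_carrier[OF f, of m \<beta>] fam_Z_carrier[OF g, of n \<beta>']
      by (auto simp: rmul2_def lmul2_def del_def coeff_mat_out intro!: sum.neutral)
    then show ?thesis using del_out[OF False] by (simp add: plus_fun_apply)
  qed
qed

lemma del_add:
  assumes f: "f \<in> fam_Z" and g: "g \<in> fam_Z"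
  shows "del (fam_add f g) = del f + del g"
proof (rule fam2_eqI)
  fix m n \<beta> \<beta>' a b c d
  show "del (fam_add f g) m n \<beta> \<beta>' (a, b) (c, d) = (del f + del g) m n \<beta> \<beta>' (a, b) (c, d)"
  proof (cases "\<beta> \<in> carrier_mat m m \<and> \<beta>' \<in> carrier_mat n n \<and> a < m \<and> b < m \<and> c < n \<and> d < n")
    case True
    define M where "M \<epsilon> = four_block_mat \<beta> (scaled_unit m n b c \<epsilon>) (0\<^sub>m n m) \<beta>'" for \<epsilon>
    have dims: "dim_row (g k \<beta>) = k" "dim_col (g k \<beta>) = k" for k \<beta>
      using fam_Z_carrier[OF g, of k \<beta>] by auto
    have "(\<lambda>\<epsilon>. f (m + n) (M \<epsilon>) $$ (a, m + d)) field_differentiable at 0"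
      "(\<lambda>\<epsilon>. g (m + n) (M \<epsilon>) $$ (a, m + d)) field_differentiable at 0"
      unfolding M_def using True f g by (intro fam_Z_differentiable; auto)+
    then show ?thesis
      using True unfolding M_def
      by (simp add: plus_fun_apply del_def fam_add_def dims deriv_add)
  next
    case False
    then show ?thesis by (simp add: del_out plus_fun_apply)
  qed
qed

lemma del_const: "del (fam_scale c fam_one) = 0"
proof (rule fam2_eqI)
  fix m n \<beta> \<beta>' a b k d
  show "del (fam_scale c fam_one) m n \<beta> \<beta>' (a, b) (k, d) = 0 m n \<beta> \<beta>' (a, b) (k, d)"
    by (auto simp: zero_fun_apply del_def fam_scale_def fam_one_def scaled_unit_def)
qed

lemma del_one: "del fam_one = 0"
  using del_const[of 1] by (simp add: fam_scale_one)


section \<open>The tensor square\<close>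

lemma tensor_add_left:
  assumes "f \<in> fam_Z" "f' \<in> fam_Z"
  shows "fam_add f f' \<otimes>\<^sub>f g = f \<otimes>\<^sub>f g + f' \<otimes>\<^sub>f g"
  by (rule fam2_eqI) (simp add: plus_fun_apply tensor_def coeff_fam_add assms algebra_simps)

lemma tensor_add_right:
  assumes "g \<in> fam_Z" "g' \<in> fam_Z"
  shows "f \<otimes>\<^sub>f fam_add g g' = f \<otimes>\<^sub>f g + f \<otimes>\<^sub>f g'"
  by (rule fam2_eqI) (simp add: plus_fun_apply tensor_def coeff_fam_add assms algebra_simps)

lemma zero_in_Z2: "0 \<in> fam_Z2"
  unfolding fam_Z2_def by (auto intro: exI[of _ 0])

lemma Z2_add_tensor_rep:
  fixes f g :: "nat \<Rightarrow> 'b::complex_unital_banach_algebra fam"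
  shows "(\<Sum>i<k. f i \<otimes>\<^sub>f g i) + a \<otimes>\<^sub>f b = (\<Sum>i<Suc k. (f(k := a)) i \<otimes>\<^sub>f (g(k := b)) i)"
  by simp

lemma Z2_add_tensor:
  assumes "\<xi> \<in> fam_Z2" "a \<in> fam_Z" "b \<in> fam_Z"
  shows "\<xi> + a \<otimes>\<^sub>f b \<in> fam_Z2"
proof -
  obtain k f g where "\<forall>i<k. f i \<in> fam_Z \<and> g i \<in> fam_Z" "\<xi> = (\<Sum>i<(k::nat). f i \<otimes>\<^sub>f g i)"
    using assms(1) unfolding fam_Z2_def by blast
  then show ?thesis
    using assms(2,3) unfolding fam_Z2_def
    by (intro CollectI exI[of _ "Suc k"] exI[of _ "f(k := a)"] exI[of _ "g(k := b)"])
      (auto simp: less_Suc_eq)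
qed

lemma tensor_in_Z2: "f \<in> fam_Z \<Longrightarrow> g \<in> fam_Z \<Longrightarrow> f \<otimes>\<^sub>f g \<in> fam_Z2"
  using Z2_add_tensor[OF zero_in_Z2] by simp

lemma fam_Z2_induct [consumes 1, case_names zero add]:
  assumes "\<xi> \<in> fam_Z2" and "P 0"
    and step: "\<And>\<xi> f g. \<xi> \<in> fam_Z2 \<Longrightarrow> f \<in> fam_Z \<Longrightarrow> g \<in> fam_Z \<Longrightarrow> P \<xi> \<Longrightarrow> P (\<xi> + f \<otimes>\<^sub>f g)"
  shows "P \<xi>"
proof -
  have "P (\<Sum>i<k. f i \<otimes>\<^sub>f g i)" if "\<forall>i<k. f i \<in> fam_Z \<and> g i \<in> fam_Z" for k :: nat and f g
    using that
  proof (induction k)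
    case 0
    then show ?case using assms(2) by simp
  next
    case (Suc k)
    have "(\<Sum>i<k. f i \<otimes>\<^sub>f g i) \<in> fam_Z2"
      using Suc.prems unfolding fam_Z2_def
      by (intro CollectI exI[of _ k] exI[of _ f] exI[of _ g]) auto
    then show ?case using step[of _ "f k" "g k"] Suc by simp
  qed
  then show ?thesis using assms(1) unfolding fam_Z2_def by blast
qed

lemma Z2_add: "\<eta> \<in> fam_Z2 \<Longrightarrow> \<xi> \<in> fam_Z2 \<Longrightarrow> \<xi> + \<eta> \<in> fam_Z2"
  by (induction rule: fam_Z2_induct) (auto simp: Z2_add_tensor add.assoc[symmetric])

lemma rmul2_add: "rmul2 g (\<xi> + \<eta>) = rmul2 g \<xi> + rmul2 g \<eta>"
  by (rule fam2_eqI) (simp add: plus_fun_apply rmul2_def algebra_simps sum.distrib)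

lemma lmul2_add: "lmul2 f (\<xi> + \<eta>) = lmul2 f \<xi> + lmul2 f \<eta>"
  by (rule fam2_eqI) (simp add: plus_fun_apply lmul2_def algebra_simps sum.distrib)

lemma mul2_zero: "rmul2 g 0 = 0" "lmul2 f 0 = 0"
  by (rule fam2_eqI, simp add: zero_fun_apply rmul2_def lmul2_def)+

lemma rmul2_tensor: "b \<in> fam_Z \<Longrightarrow> g \<in> fam_Z \<Longrightarrow> rmul2 g (a \<otimes>\<^sub>f b) = a \<otimes>\<^sub>f fam_mult b g"
  by (rule fam2_eqI) (simp add: rmul2_def tensor_def coeff_fam_mult sum_distrib_left mult.assoc)

lemma lmul2_tensor: "a \<in> fam_Z \<Longrightarrow> f \<in> fam_Z \<Longrightarrow> lmul2 f (a \<otimes>\<^sub>f b) = fam_mult f a \<otimes>\<^sub>f b"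
  by (rule fam2_eqI) (simp add: lmul2_def tensor_def coeff_fam_mult sum_distrib_right mult.assoc)

lemma rmul2_Z2: "\<xi> \<in> fam_Z2 \<Longrightarrow> g \<in> fam_Z \<Longrightarrow> rmul2 g \<xi> \<in> fam_Z2"
  by (induction rule: fam_Z2_induct)
    (auto simp: mul2_zero zero_in_Z2 rmul2_add rmul2_tensor fam_Z_mult intro!: Z2_add_tensor)

lemma lmul2_Z2: "\<xi> \<in> fam_Z2 \<Longrightarrow> f \<in> fam_Z \<Longrightarrow> lmul2 f \<xi> \<in> fam_Z2"
  by (induction rule: fam_Z2_induct)
    (auto simp: mul2_zero zero_in_Z2 lmul2_add lmul2_tensor fam_Z_mult intro!: Z2_add_tensor)

lemma del_gen:
  assumes "\<phi> \<in> top_dual"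
  shows "del (fam_z \<phi>) = fam_scale (\<phi> 1) fam_one \<otimes>\<^sub>f fam_one"
  unfolding del_fam_z[OF assms]
  by (intro ext) (simp add: tensor_def fam_scale_def coeff_mat_smult)

lemma del_in_Z2: "f \<in> fam_Z \<Longrightarrow> del f \<in> fam_Z2"
  by (induction rule: fam_Z_induct)
    (simp_all add: del_const zero_in_Z2 del_gen tensor_in_Z2 fam_Z_scale fam_Z_one del_add Z2_add
      del_mult rmul2_Z2 lmul2_Z2)


section \<open>Coassociativity of the difference quotient\<close>

lemma del_id_zero: "del_id 0 = 0"
  using del_id_sum[of 0] by simp

lemma id_del_zero: "id_del 0 = 0"
  using id_del_sum[of 0] by simp

lemma del_id_add_tensor:
  assumes "\<xi> \<in> fam_Z2" "a \<in> fam_Z" "b \<in> fam_Z"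
  shows "del_id (\<xi> + a \<otimes>\<^sub>f b) = del_id \<xi> + tensor21 (del a) b"
proof -
  obtain k f g where fg: "\<forall>i<k. f i \<in> fam_Z \<and> g i \<in> fam_Z" "\<xi> = (\<Sum>i<(k::nat). f i \<otimes>\<^sub>f g i)"
    using assms(1) unfolding fam_Z2_def by blast
  show ?thesis
    unfolding fg(2) Z2_add_tensor_rep using fg(1) assms(2,3)
    by (subst (1 2) del_id_sum) (auto simp: less_Suc_eq)
qed

lemma id_del_add_tensor:
  assumes "\<xi> \<in> fam_Z2" "a \<in> fam_Z" "b \<in> fam_Z"
  shows "id_del (\<xi> + a \<otimes>\<^sub>f b) = id_del \<xi> + tensor12 a (del b)"
proof -
  obtain k f g where fg: "\<forall>i<k. f i \<in> fam_Z \<and> g i \<in> fam_Z" "\<xi> = (\<Sum>i<(k::nat). f i \<otimes>\<^sub>f g i)"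
    using assms(1) unfolding fam_Z2_def by blast
  show ?thesis
    unfolding fg(2) Z2_add_tensor_rep using fg(1) assms(2,3)
    by (subst (1 2) id_del_sum) (auto simp: less_Suc_eq)
qed

lemma del_id_tensor: "a \<in> fam_Z \<Longrightarrow> b \<in> fam_Z \<Longrightarrow> del_id (a \<otimes>\<^sub>f b) = tensor21 (del a) b"
  using del_id_add_tensor[OF zero_in_Z2] by (simp add: del_id_zero)

lemma id_del_tensor: "a \<in> fam_Z \<Longrightarrow> b \<in> fam_Z \<Longrightarrow> id_del (a \<otimes>\<^sub>f b) = tensor12 a (del b)"
  using id_del_add_tensor[OF zero_in_Z2] by (simp add: id_del_zero)

lemma del_id_add: "\<eta> \<in> fam_Z2 \<Longrightarrow> \<xi> \<in> fam_Z2 \<Longrightarrow> del_id (\<xi> + \<eta>) = del_id \<xi> + del_id \<eta>"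
proof (induction rule: fam_Z2_induct)
  case (add \<eta> f g)
  then show ?case by (simp add: del_id_add_tensor Z2_add add.assoc[symmetric])
qed (simp add: del_id_zero)

lemma id_del_add: "\<eta> \<in> fam_Z2 \<Longrightarrow> \<xi> \<in> fam_Z2 \<Longrightarrow> id_del (\<xi> + \<eta>) = id_del \<xi> + id_del \<eta>"
proof (induction rule: fam_Z2_induct)
  case (add \<eta> f g)
  then show ?case by (simp add: id_del_add_tensor Z2_add add.assoc[symmetric])
qed (simp add: id_del_zero)

text \<open>
  \<open>rmul3 g T\<close> is \<open>T (1 \<otimes> 1 \<otimes> g)\<close> and \<open>lmul3 f T\<close> is \<open>(f \<otimes> 1 \<otimes> 1) T\<close>; \<open>mid_mult\<close> is the bilinear map
  sending \<open>a \<otimes> b\<close> and \<open>c \<otimes> d\<close> to \<open>a \<otimes> b c \<otimes> d\<close>.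
\<close>

definition rmul3 :: "'b fam \<Rightarrow> 'b fam3 \<Rightarrow> 'b fam3" where
  "rmul3 g T = (\<lambda>m n p \<beta> \<beta>' \<beta>'' u v (c, d).
     \<Sum>k<p. T m n p \<beta> \<beta>' \<beta>'' u v (c, k) * coeff_mat (g p \<beta>'') (k, d))"

definition lmul3 :: "'b fam \<Rightarrow> 'b fam3 \<Rightarrow> 'b fam3" where
  "lmul3 f T = (\<lambda>m n p \<beta> \<beta>' \<beta>'' (a, b) v w.
     \<Sum>k<m. coeff_mat (f m \<beta>) (a, k) * T m n p \<beta> \<beta>' \<beta>'' (k, b) v w)"

definition mid_mult :: "'b fam2 \<Rightarrow> 'b fam2 \<Rightarrow> 'b fam3" where
  "mid_mult \<xi> \<eta> = (\<lambda>m n p \<beta> \<beta>' \<beta>'' u (c, d) w.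
     \<Sum>k<n. \<xi> m n \<beta> \<beta>' u (c, k) * \<eta> n p \<beta>' \<beta>'' (k, d) w)"

lemma mul3_add: "rmul3 g (S + T) = rmul3 g S + rmul3 g T" "lmul3 g (S + T) = lmul3 g S + lmul3 g T"
  by (rule fam3_eqI, simp add: plus_fun_apply rmul3_def lmul3_def algebra_simps sum.distrib)+

lemma mul3_zero: "rmul3 g 0 = 0" "lmul3 g 0 = 0"
  by (rule fam3_eqI, simp add: zero_fun_apply rmul3_def lmul3_def)+

lemma mid_mult_add:
  "mid_mult (\<xi> + \<xi>') \<eta> = mid_mult \<xi> \<eta> + mid_mult \<xi>' \<eta>"
  "mid_mult \<xi> (\<eta> + \<eta>') = mid_mult \<xi> \<eta> + mid_mult \<xi> \<eta>'"
  by (rule fam3_eqI, simp add: plus_fun_apply mid_mult_def algebra_simps sum.distrib)+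

lemma mid_mult_zero: "mid_mult 0 \<eta> = 0" "mid_mult \<xi> 0 = 0"
  by (rule fam3_eqI, simp add: zero_fun_apply mid_mult_def)+

lemma del_id_rmul2:
  "\<xi> \<in> fam_Z2 \<Longrightarrow> g \<in> fam_Z \<Longrightarrow> del_id (rmul2 g \<xi>) = rmul3 g (del_id \<xi>)"
proof (induction rule: fam_Z2_induct)
  case (add \<xi> a b)
  have "tensor21 (del a) (fam_mult b g) = rmul3 g (tensor21 (del a) b)"
    by (rule fam3_eqI)
      (simp add: tensor21_def rmul3_def coeff_fam_mult add sum_distrib_left mult.assoc)
  then show ?case
    using add by (simp add: rmul2_add rmul2_tensor del_id_add_tensor rmul2_Z2 fam_Z_mult mul3_add)
qed (simp add: mul2_zero mul3_zero del_id_zero)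

lemma id_del_lmul2:
  "\<xi> \<in> fam_Z2 \<Longrightarrow> f \<in> fam_Z \<Longrightarrow> id_del (lmul2 f \<xi>) = lmul3 f (id_del \<xi>)"
proof (induction rule: fam_Z2_induct)
  case (add \<xi> a b)
  have "tensor12 (fam_mult f a) (del b) = lmul3 f (tensor12 a (del b))"
    by (rule fam3_eqI)
      (simp add: tensor12_def lmul3_def coeff_fam_mult add sum_distrib_right mult.assoc)
  then show ?case
    using add by (simp add: lmul2_add lmul2_tensor id_del_add_tensor lmul2_Z2 fam_Z_mult mul3_add)
qed (simp add: mul2_zero mul3_zero id_del_zero)

lemma id_del_rmul2:
  "\<xi> \<in> fam_Z2 \<Longrightarrow> g \<in> fam_Z \<Longrightarrow> id_del (rmul2 g \<xi>) = rmul3 g (id_del \<xi>) + mid_mult \<xi> (del g)"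
proof (induction rule: fam_Z2_induct)
  case (add \<xi> a b)
  have "tensor12 a (rmul2 g (del b) + lmul2 b (del g)) =
      rmul3 g (tensor12 a (del b)) + mid_mult (a \<otimes>\<^sub>f b) (del g)"
    by (rule fam3_eqI)
      (simp add: plus_fun_apply tensor12_def rmul3_def mid_mult_def rmul2_def lmul2_def tensor_def
        sum_distrib_left distrib_left mult.assoc)
  then show ?case
    using add by (simp add: rmul2_add rmul2_tensor id_del_add_tensor rmul2_Z2 fam_Z_mult mul3_add
        del_mult mid_mult_add)
qed (simp add: mul2_zero mul3_zero id_del_zero mid_mult_zero)

lemma del_id_lmul2:
  "\<xi> \<in> fam_Z2 \<Longrightarrow> f \<in> fam_Z \<Longrightarrow> del_id (lmul2 f \<xi>) = lmul3 f (del_id \<xi>) + mid_mult (del f) \<xi>"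
proof (induction rule: fam_Z2_induct)
  case (add \<xi> a b)
  have "tensor21 (rmul2 a (del f) + lmul2 f (del a)) b =
      lmul3 f (tensor21 (del a) b) + mid_mult (del f) (a \<otimes>\<^sub>f b)"
    by (rule fam3_eqI)
      (simp add: plus_fun_apply tensor21_def lmul3_def mid_mult_def rmul2_def lmul2_def tensor_def
        sum_distrib_right distrib_right mult.assoc)
  then show ?case
    using add by (simp add: lmul2_add lmul2_tensor del_id_add_tensor lmul2_Z2 fam_Z_mult mul3_add
        del_mult mid_mult_add)
qed (simp add: mul2_zero mul3_zero del_id_zero mid_mult_zero)

text \<open>
  On a product \<open>f g\<close> both sides acquire the same mixed term \<open>mid_mult (\<partial>f) (\<partial>g)\<close>: the left hand
  side from differentiating the first leg of \<open>(f \<otimes> 1) \<partial>g\<close>, the right hand side from differentiating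
  the second leg of \<open>\<partial>f (1 \<otimes> g)\<close>.
\<close>

theorem del_coassociative: "f \<in> fam_Z \<Longrightarrow> del_id (del f) = id_del (del f)"
proof (induction rule: fam_Z_induct)
  case (const c)
  then show ?case by (simp add: del_const del_id_zero id_del_zero)
next
  case (gen \<phi>)
  then show ?case
    using gen by (simp add: del_gen del_id_tensor id_del_tensor fam_Z_scale fam_Z_one del_const del_one)
      (intro ext, simp add: tensor21_def tensor12_def zero_fun_apply)
next
  case (add f g)
  then show ?case by (simp add: del_add del_id_add id_del_add del_in_Z2)
next
  case (mult f g)
  then show ?case
    by (simp add: del_mult del_id_add id_del_add rmul2_Z2 lmul2_Z2 del_in_Z2 del_id_rmul2
        del_id_lmul2 id_del_rmul2 id_del_lmul2 algebra_simps)
qed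


section \<open>The number operators\<close>

lemma Z2_out:
  assumes "\<xi> \<in> fam_Z2" "m \<le> a \<or> m \<le> b \<or> n \<le> c \<or> n \<le> d"
  shows "\<xi> m n \<beta> \<beta>' (a, b) (c, d) = 0"
  using assms(1)
proof (induction rule: fam_Z2_induct)
  case (add \<xi> f g)
  then show ?case
    using assms(2) coeff_mat_out[OF fam_Z_carrier[of f m \<beta>], of a b]
      coeff_mat_out[OF fam_Z_carrier[of g n \<beta>'], of c d]
    by (auto simp: plus_fun_apply tensor_def)
qed (simp add: zero_fun_apply)

lemma coeff_del_star:
  assumes "\<theta> \<in> top_dual" "\<xi> \<in> fam_Z2"
  shows "coeff_mat (del_star \<theta> \<xi> n \<beta>) (i, j) =
    (\<Sum>k<n. \<Sum>l<n. \<xi> n n \<beta> \<beta> (i, k) (l, j) * coeff_mat (fam_z \<theta> n \<beta>) (k, l))"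
proof (cases "i < n \<and> j < n")
  case True
  then show ?thesis
    by (simp add: del_star_def coeff_mat_sharp coeff_mat_fam_Z[OF fam_z_in_Z[OF assms(1)]])
next
  case False
  then show ?thesis
    by (auto simp: del_star_def coeff_mat_sharp Z2_out[OF assms(2)] intro!: sum.neutral)
qed

lemma fam_mult_one_left: "f \<in> fam_Z \<Longrightarrow> fam_mult fam_one f = f"
  using fam_mult_const_left[of f 1] by (simp add: fam_scale_one)
    (rule fam_Z_eqI; simp add: fam_Z_scale coeff_fam_scale)

lemma fam_mult_one_right:
  assumes "f \<in> fam_Z"
  shows "fam_mult f fam_one = f"
proof (intro ext)
  fix n \<beta>
  show "fam_mult f fam_one n \<beta> = f n \<beta>"
    using fam_Z_carrier[OF assms, of n \<beta>] fam_Z_zero_outside[OF assms, of \<beta> n]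
    by (cases "\<beta> \<in> carrier_mat n n") (simp_all add: fam_mult_def fam_one_def)
qed

lemma del_star_tensor:
  assumes "\<theta> \<in> top_dual" "f \<in> fam_Z" "g \<in> fam_Z"
  shows "del_star \<theta> (f \<otimes>\<^sub>f g) = fam_mult (fam_mult f (fam_z \<theta>)) g"
proof (intro ext)
  fix n \<beta>
  have "coeff_mat (del_star \<theta> (f \<otimes>\<^sub>f g) n \<beta>) (i, j) =
      coeff_mat (fam_mult (fam_mult f (fam_z \<theta>)) g n \<beta>) (i, j)" for i j
  proof -
    have "coeff_mat (del_star \<theta> (f \<otimes>\<^sub>f g) n \<beta>) (i, j) = (\<Sum>k<n. \<Sum>l<n.
        coeff_mat (f n \<beta>) (i, k) * coeff_mat (fam_z \<theta> n \<beta>) (k, l) * coeff_mat (g n \<beta>) (l, j))"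
      unfolding coeff_del_star[OF assms(1) tensor_in_Z2[OF assms(2,3)]]
      by (simp add: tensor_def mult_ac)
    also have "\<dots> = coeff_mat (fam_mult (fam_mult f (fam_z \<theta>)) g n \<beta>) (i, j)"
      by (subst sum.swap) (simp add: coeff_fam_mult assms fam_Z_mult fam_z_in_Z sum_distrib_right)
    finally show ?thesis .
  qed
  then show "del_star \<theta> (f \<otimes>\<^sub>f g) n \<beta> = fam_mult (fam_mult f (fam_z \<theta>)) g n \<beta>"
    using assms
    by (intro coeff_mat_eqI[of "del_star \<theta> (f \<otimes>\<^sub>f g) n \<beta>" n, OF _ fam_Z_carrier])
      (simp_all add: fam_Z_mult fam_z_in_Z del_star_def sharp_def)
qed

lemma del_star_add: "del_star \<theta> (\<xi> + \<eta>) = fam_add (del_star \<theta> \<xi>) (del_star \<theta> \<eta>)"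
  by (intro ext eq_matI)
    (auto simp: del_star_def sharp_def fam_add_def plus_fun_apply distrib_right sum.distrib)

lemma del_star_zero: "del_star \<theta> 0 = fam_scale 0 fam_one"
  by (intro ext eq_matI)
    (auto simp: del_star_def sharp_def fam_scale_def fam_one_def zero_fun_apply split: if_splits)

lemma del_star_in_Z: "\<xi> \<in> fam_Z2 \<Longrightarrow> \<theta> \<in> top_dual \<Longrightarrow> del_star \<theta> \<xi> \<in> fam_Z"
  by (induction rule: fam_Z2_induct)
    (simp_all add: del_star_zero del_star_add del_star_tensor fam_Z_add fam_Z_mult fam_Z_scale
      fam_Z_one fam_z_in_Z)

lemma num_op_eq: "num_op \<theta> f = del_star \<theta> (del f)"
  by (simp add: num_op_def)

lemma num_op_in_Z: "f \<in> fam_Z \<Longrightarrow> \<theta> \<in> top_dual \<Longrightarrow> num_op \<theta> f \<in> fam_Z"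
  by (simp add: num_op_eq del_star_in_Z del_in_Z2)

lemma num_op_add:
  "f \<in> fam_Z \<Longrightarrow> g \<in> fam_Z \<Longrightarrow> num_op \<theta> (fam_add f g) = fam_add (num_op \<theta> f) (num_op \<theta> g)"
  by (simp add: num_op_eq del_add del_star_add)

lemma num_op_const: "num_op \<theta> (fam_scale c fam_one) = fam_scale 0 fam_one"
  by (simp add: num_op_eq del_const del_star_zero)

lemma del_star_rmul2:
  assumes "\<xi> \<in> fam_Z2" "g \<in> fam_Z" "\<theta> \<in> top_dual"
  shows "del_star \<theta> (rmul2 g \<xi>) = fam_mult (del_star \<theta> \<xi>) g"
  using assms(1)
proof (induction rule: fam_Z2_induct)
  case zero
  show ?case using assms(2)
    by (simp add: mul2_zero del_star_zero fam_mult_const_left)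
      (rule fam_Z_eqI; simp add: fam_Z_scale fam_Z_one coeff_fam_scale)
next
  case (add \<xi> a b)
  then show ?case using assms(2,3)
    by (simp add: rmul2_add rmul2_tensor del_star_add del_star_tensor fam_Z_mult fam_z_in_Z
        fam_mult_assoc fam_mult_add_left del_star_in_Z)
qed

lemma del_star_lmul2:
  assumes "\<xi> \<in> fam_Z2" "f \<in> fam_Z" "\<theta> \<in> top_dual"
  shows "del_star \<theta> (lmul2 f \<xi>) = fam_mult f (del_star \<theta> \<xi>)"
  using assms(1)
proof (induction rule: fam_Z2_induct)
  case zero
  show ?case using assms(2)
    by (simp add: mul2_zero del_star_zero)
      (rule fam_Z_eqI; simp add: fam_Z_scale fam_Z_one fam_Z_mult coeff_fam_scale coeff_fam_mult)
next
  case (add \<xi> a b)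
  then show ?case using assms(2,3)
    by (simp add: lmul2_add lmul2_tensor del_star_add del_star_tensor fam_Z_mult fam_z_in_Z
        fam_mult_assoc fam_mult_add_right del_star_in_Z)
qed

lemma num_op_mult:
  assumes "f \<in> fam_Z" "g \<in> fam_Z" "\<theta> \<in> top_dual"
  shows "num_op \<theta> (fam_mult f g) = fam_add (fam_mult (num_op \<theta> f) g) (fam_mult f (num_op \<theta> g))"
  using assms by (simp add: num_op_eq del_mult del_star_add del_star_rmul2 del_star_lmul2 del_in_Z2)

lemma num_op_gen:
  assumes "\<theta> \<in> top_dual" "\<phi> \<in> top_dual"
  shows "num_op \<theta> (fam_z \<phi>) = fam_scale (\<phi> 1) (fam_z \<theta>)"
  using assms
  by (simp add: num_op_eq del_gen del_star_tensor fam_Z_scale fam_Z_one fam_mult_one_right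
      fam_mult_const_left fam_z_in_Z)

lemma num_op2_zero: "num_op2 \<theta> 0 = 0"
  unfolding num_op2_def
  using num_op_id_sum[of 0 undefined undefined \<theta>] id_num_op_sum[of 0 undefined undefined \<theta>] by simp

lemma num_op2_add_tensor:
  assumes "\<xi> \<in> fam_Z2" "a \<in> fam_Z" "b \<in> fam_Z"
  shows "num_op2 \<theta> (\<xi> + a \<otimes>\<^sub>f b) =
    num_op2 \<theta> \<xi> + (num_op \<theta> a \<otimes>\<^sub>f b + a \<otimes>\<^sub>f num_op \<theta> b + a \<otimes>\<^sub>f b)"
proof -
  obtain k f g where fg: "\<forall>i<k. f i \<in> fam_Z \<and> g i \<in> fam_Z" "\<xi> = (\<Sum>i<(k::nat). f i \<otimes>\<^sub>f g i)"
    using assms(1) unfolding fam_Z2_def by blast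
  have "tensor_lift (\<lambda>f g. num_op \<theta> f \<otimes>\<^sub>f g) (\<xi> + a \<otimes>\<^sub>f b) =
      tensor_lift (\<lambda>f g. num_op \<theta> f \<otimes>\<^sub>f g) \<xi> + num_op \<theta> a \<otimes>\<^sub>f b"
    unfolding fg(2) Z2_add_tensor_rep using fg(1) assms(2,3)
    by (subst (1 2) num_op_id_sum) (auto simp: less_Suc_eq)
  moreover have "tensor_lift (\<lambda>f g. f \<otimes>\<^sub>f num_op \<theta> g) (\<xi> + a \<otimes>\<^sub>f b) =
      tensor_lift (\<lambda>f g. f \<otimes>\<^sub>f num_op \<theta> g) \<xi> + a \<otimes>\<^sub>f num_op \<theta> b"
    unfolding fg(2) Z2_add_tensor_rep using fg(1) assms(2,3)
    by (subst (1 2) id_num_op_sum) (auto simp: less_Suc_eq)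
  ultimately show ?thesis by (simp add: num_op2_def algebra_simps)
qed

lemma num_op2_tensor:
  "a \<in> fam_Z \<Longrightarrow> b \<in> fam_Z \<Longrightarrow>
    num_op2 \<theta> (a \<otimes>\<^sub>f b) = num_op \<theta> a \<otimes>\<^sub>f b + a \<otimes>\<^sub>f num_op \<theta> b + a \<otimes>\<^sub>f b"
  using num_op2_add_tensor[OF zero_in_Z2, of a b] by (simp add: num_op2_zero)

lemma num_op2_add:
  "\<eta> \<in> fam_Z2 \<Longrightarrow> \<xi> \<in> fam_Z2 \<Longrightarrow> num_op2 \<theta> (\<xi> + \<eta>) = num_op2 \<theta> \<xi> + num_op2 \<theta> \<eta>"
proof (induction rule: fam_Z2_induct)
  case (add \<eta> f g)
  then show ?case by (simp add: num_op2_add_tensor Z2_add add.assoc[symmetric])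
qed (simp add: num_op2_zero)

text \<open>
  Here \<open>\<theta> 1 = 1\<close> enters: the number operator fixes \<open>z(\<theta>)\<close>, so differentiating the middle factor
  of \<open>f z(\<theta>) g\<close> gives the summand \<open>f \<otimes> g\<close> of the number operator on the tensor square.
\<close>

lemma num_op_del_star:
  assumes "\<theta> \<in> top_dual" "\<theta> 1 = 1" "\<xi> \<in> fam_Z2"
  shows "num_op \<theta> (del_star \<theta> \<xi>) = del_star \<theta> (num_op2 \<theta> \<xi>)"
  using assms(3)
proof (induction rule: fam_Z2_induct)
  case zero
  show ?case by (simp add: num_op2_zero del_star_zero num_op_const)
next
  case (add \<xi> f g)
  note Z = assms(1) add.hyps num_op_in_Z fam_Z_mult fam_Z_add fam_z_in_Z
  have z: "num_op \<theta> (fam_z \<theta>) = fam_z \<theta>"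
    unfolding num_op_gen[OF assms(1,1)] assms(2)
    by (rule fam_Z_eqI) (simp_all add: Z fam_Z_scale coeff_fam_scale)
  have "num_op \<theta> (del_star \<theta> (\<xi> + f \<otimes>\<^sub>f g)) = fam_add (del_star \<theta> (num_op2 \<theta> \<xi>))
      (fam_add (fam_mult (fam_add (fam_mult (num_op \<theta> f) (fam_z \<theta>)) (fam_mult f (fam_z \<theta>))) g)
        (fam_mult (fam_mult f (fam_z \<theta>)) (num_op \<theta> g)))"
    by (simp add: del_star_add del_star_tensor num_op_add num_op_mult Z del_star_in_Z add.IH z)
  also have "\<dots> = del_star \<theta> (num_op2 \<theta> (\<xi> + f \<otimes>\<^sub>f g))"
  proof -
    have "fam_add (fam_mult (fam_add (fam_mult (num_op \<theta> f) (fam_z \<theta>)) (fam_mult f (fam_z \<theta>))) g)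
        (fam_mult (fam_mult f (fam_z \<theta>)) (num_op \<theta> g)) =
        del_star \<theta> (num_op \<theta> f \<otimes>\<^sub>f g + f \<otimes>\<^sub>f num_op \<theta> g + f \<otimes>\<^sub>f g)"
      by (rule fam_Z_eqI)
        (simp_all add: del_star_add del_star_tensor Z fam_mult_add_left coeff_fam_add)
    then show ?thesis
      by (simp only: num_op2_add_tensor[OF add.hyps] del_star_add)
  qed
  finally show ?case .
qed


section \<open>Contractions against the distinguished generator\<close>

text \<open>
  With \<open>X = z(\<theta>)\<close>, the maps \<open>contract12\<close> and \<open>contract23\<close> send \<open>a \<otimes> b \<otimes> c\<close> to \<open>a X b \<otimes> c\<close> and to
  \<open>a \<otimes> b X c\<close>.
\<close>

definition contract12 ::
    "('b::complex_unital_banach_algebra \<Rightarrow> complex) \<Rightarrow> 'b fam3 \<Rightarrow> 'b fam2" where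
  "contract12 \<theta> T = (\<lambda>m n \<beta> \<beta>' (a, b) v. \<Sum>k<m. \<Sum>l<m.
     T m m n \<beta> \<beta> \<beta>' (a, k) (l, b) v * coeff_mat (fam_z \<theta> m \<beta>) (k, l))"

definition contract23 ::
    "('b::complex_unital_banach_algebra \<Rightarrow> complex) \<Rightarrow> 'b fam3 \<Rightarrow> 'b fam2" where
  "contract23 \<theta> T = (\<lambda>m n \<beta> \<beta>' u (c, d). \<Sum>k<n. \<Sum>l<n.
     T m n n \<beta> \<beta>' \<beta>' u (c, k) (l, d) * coeff_mat (fam_z \<theta> n \<beta>') (k, l))"

lemma contract_add:
  "contract12 \<theta> (S + T) = contract12 \<theta> S + contract12 \<theta> T"
  "contract23 \<theta> (S + T) = contract23 \<theta> S + contract23 \<theta> T"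
  by (rule fam2_eqI,
      simp add: plus_fun_apply contract12_def contract23_def distrib_right sum.distrib)+

lemma contract_zero: "contract12 \<theta> 0 = 0" "contract23 \<theta> 0 = 0"
  by (rule fam2_eqI, simp add: zero_fun_apply contract12_def contract23_def)+

text \<open>
  Contracting the two legs produced by \<open>\<partial>\<close> with each other gives the number operator; contracting
  across the original tensor sign gives the outer terms of the Leibniz rule for \<open>f z(\<theta>) g\<close>.
\<close>

lemma contract_adjacent:
  assumes "\<theta> \<in> top_dual" "f \<in> fam_Z" "g \<in> fam_Z"
  shows "contract12 \<theta> (tensor21 (del f) g) = num_op \<theta> f \<otimes>\<^sub>f g"
    and "contract23 \<theta> (tensor12 f (del g)) = f \<otimes>\<^sub>f num_op \<theta> g"
  by (rule fam2_eqI,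
      simp add: contract12_def contract23_def tensor12_def tensor21_def tensor_def num_op_eq
        coeff_del_star assms del_in_Z2 sum_distrib_left sum_distrib_right mult_ac)+

lemma contract_across:
  assumes "\<theta> \<in> top_dual" "f \<in> fam_Z" "g \<in> fam_Z"
  shows "contract23 \<theta> (tensor21 (del f) g) = rmul2 (fam_mult (fam_z \<theta>) g) (del f)"
    and "contract12 \<theta> (tensor12 f (del g)) = lmul2 (fam_mult f (fam_z \<theta>)) (del g)"
proof -
  show "contract23 \<theta> (tensor21 (del f) g) = rmul2 (fam_mult (fam_z \<theta>) g) (del f)"
    by (rule fam2_eqI)
      (simp add: contract23_def tensor21_def rmul2_def coeff_fam_mult assms fam_z_in_Z
        sum_distrib_left mult_ac)
  show "contract12 \<theta> (tensor12 f (del g)) = lmul2 (fam_mult f (fam_z \<theta>)) (del g)"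
  proof (rule fam2_eqI)
    fix m n \<beta> \<beta>' a b c d
    have "contract12 \<theta> (tensor12 f (del g)) m n \<beta> \<beta>' (a, b) (c, d) = (\<Sum>l<m. \<Sum>k<m.
        coeff_mat (f m \<beta>) (a, k) * coeff_mat (fam_z \<theta> m \<beta>) (k, l) * del g m n \<beta> \<beta>' (l, b) (c, d))"
      by (subst sum.swap) (simp add: contract12_def tensor12_def mult_ac)
    then show "contract12 \<theta> (tensor12 f (del g)) m n \<beta> \<beta>' (a, b) (c, d) =
        lmul2 (fam_mult f (fam_z \<theta>)) (del g) m n \<beta> \<beta>' (a, b) (c, d)"
      by (simp add: lmul2_def coeff_fam_mult assms fam_z_in_Z sum_distrib_right)
  qed
qed

theorem num_op2_contract:
  assumes "\<theta> \<in> top_dual" "\<xi> \<in> fam_Z2"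
  shows "num_op2 \<theta> \<xi> = contract12 \<theta> (del_id \<xi>) + \<xi> + contract23 \<theta> (id_del \<xi>)"
  using assms(2)
proof (induction rule: fam_Z2_induct)
  case zero
  show ?case by (simp add: num_op2_zero del_id_zero id_del_zero contract_zero)
next
  case (add \<xi> f g)
  then show ?case
    by (simp add: num_op2_add_tensor del_id_add_tensor id_del_add_tensor contract_add
        contract_adjacent assms(1))
qed

lemma rmul2_rmul2:
  "\<xi> \<in> fam_Z2 \<Longrightarrow> g \<in> fam_Z \<Longrightarrow> h \<in> fam_Z \<Longrightarrow> rmul2 g (rmul2 h \<xi>) = rmul2 (fam_mult h g) \<xi>"
  by (induction rule: fam_Z2_induct)
    (simp_all add: mul2_zero rmul2_add rmul2_tensor fam_Z_mult fam_mult_assoc)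

theorem del_del_star_contract:
  assumes "\<theta> \<in> top_dual" "\<theta> 1 = 1" "\<xi> \<in> fam_Z2"
  shows "del (del_star \<theta> \<xi>) = contract23 \<theta> (del_id \<xi>) + \<xi> + contract12 \<theta> (id_del \<xi>)"
  using assms(3)
proof (induction rule: fam_Z2_induct)
  case zero
  show ?case by (simp add: del_star_zero del_const del_id_zero id_del_zero contract_zero)
next
  case (add \<xi> f g)
  have "del (fam_mult (fam_mult f (fam_z \<theta>)) g) =
      rmul2 (fam_mult (fam_z \<theta>) g) (del f) + f \<otimes>\<^sub>f g + lmul2 (fam_mult f (fam_z \<theta>)) (del g)"
    using add assms(1,2)
    by (simp add: del_mult fam_Z_mult fam_z_in_Z rmul2_add rmul2_rmul2 del_in_Z2 del_gen
        fam_scale_one lmul2_tensor rmul2_tensor fam_Z_one fam_mult_one_right fam_mult_one_left)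
  then show ?case
    using add assms(1)
    by (simp add: del_star_add del_star_tensor del_add del_star_in_Z fam_Z_mult fam_z_in_Z
        del_id_add_tensor id_del_add_tensor contract_add contract_across)
qed


section \<open>Bijectivity of the number operator on the tensor square\<close>

text \<open>Sums of eigenvectors of the number operator with eigenvalues in \<open>\<nat>\<close>.\<close>

inductive_set num_eigenspan ::
    "('b::complex_unital_banach_algebra \<Rightarrow> complex) \<Rightarrow> 'b fam set" for \<theta> where
  eigen: "f \<in> fam_Z \<Longrightarrow> num_op \<theta> f = fam_scale (of_nat k) f \<Longrightarrow> f \<in> num_eigenspan \<theta>"
| add: "f \<in> num_eigenspan \<theta> \<Longrightarrow> g \<in> num_eigenspan \<theta> \<Longrightarrow> fam_add f g \<in> num_eigenspan \<theta>"

lemma num_eigenspan_Z: "f \<in> num_eigenspan \<theta> \<Longrightarrow> f \<in> fam_Z"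
  by (induction rule: num_eigenspan.induct) (auto intro: fam_Z_add)

lemma num_eigenspan_mult:
  assumes "f \<in> num_eigenspan \<theta>" "g \<in> num_eigenspan \<theta>" "\<theta> \<in> top_dual"
  shows "fam_mult f g \<in> num_eigenspan \<theta>"
  using assms(1)
proof (induction rule: num_eigenspan.induct)
  case (eigen f k)
  show ?case
    using assms(2)
  proof (induction rule: num_eigenspan.induct)
    case (eigen g l)
    note f = \<open>f \<in> fam_Z\<close> \<open>num_op \<theta> f = _\<close>
    have "num_op \<theta> (fam_mult f g) = fam_scale (of_nat (k + l)) (fam_mult f g)"
      unfolding num_op_mult[OF f(1) eigen(1) assms(3)] f(2) eigen(2)
      by (rule fam_Z_eqI)
        (simp_all add: f(1) eigen(1) fam_Z_add fam_Z_mult fam_Z_scale coeff_fam_add coeff_fam_mult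
          coeff_fam_scale sum_distrib_left sum.distrib algebra_simps)
    then show ?case
      using f(1) eigen(1) fam_Z_mult num_eigenspan.eigen by blast
  next
    case (add g h)
    then show ?case
      using eigen(1) by (simp add: fam_mult_add_right num_eigenspan_Z num_eigenspan.add)
  qed
next
  case (add f h)
  then show ?case
    using num_eigenspan_Z[OF assms(2)]
    by (simp add: fam_mult_add_left num_eigenspan_Z num_eigenspan.add)
qed

lemma top_dual_lin_comb:
  assumes "\<phi> \<in> top_dual" "\<psi> \<in> top_dual"
  shows "(\<lambda>x. a * \<phi> x + c * \<psi> x) \<in> top_dual"
proof -
  have "Vector_Spaces.linear scaleC (*) \<phi>" using assms(1) by (simp add: top_dual_def)
  then have "Vector_Spaces.linear scaleC (*) (\<lambda>x. a * \<phi> x + c * \<psi> x)"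
    unfolding Vector_Spaces.linear_def module_hom_def module_hom_axioms_def
    by (auto simp: top_dualD[OF assms(1)] top_dualD[OF assms(2)] algebra_simps)
  then show ?thesis
    using assms unfolding top_dual_def by (auto intro!: continuous_intros)
qed

text \<open>
  A generator splits as \<open>z(\<phi>) = z(\<phi> - \<phi>(1) \<theta>) + \<phi>(1) z(\<theta>)\<close>, where the number operator kills the
  first summand and fixes the second.
\<close>

lemma fam_Z_subset_num_eigenspan:
  assumes "\<theta> \<in> top_dual" "\<theta> 1 = 1" "f \<in> fam_Z"
  shows "f \<in> num_eigenspan \<theta>"
  using assms(3)
proof (induction rule: fam_Z_induct)
  case (const c)
  have "num_op \<theta> (fam_scale c fam_one) = fam_scale (of_nat 0) (fam_scale c fam_one)"
    unfolding num_op_const by (rule fam_Z_eqI) (simp_all add: fam_Z_scale fam_Z_one coeff_fam_scale)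
  then show ?case
    by (intro num_eigenspan.eigen fam_Z_scale fam_Z_one)
next
  case (gen \<phi>)
  define \<phi>0 where "\<phi>0 = (\<lambda>x. 1 * \<phi> x + (- \<phi> 1) * \<theta> x)"
  define \<phi>1 where "\<phi>1 = (\<lambda>x. \<phi> 1 * \<theta> x + 0 * \<theta> x)"
  have td: "\<phi>0 \<in> top_dual" "\<phi>1 \<in> top_dual"
    unfolding \<phi>0_def \<phi>1_def
    by (rule top_dual_lin_comb[OF gen assms(1)] top_dual_lin_comb[OF assms(1,1)])+
  have "num_op \<theta> (fam_z \<phi>0) = fam_scale (of_nat 0) (fam_z \<phi>0)"
    unfolding num_op_gen[OF assms(1) td(1)] using td assms(1,2)
    by (intro fam_Z_eqI) (simp_all add: fam_Z_scale fam_z_in_Z coeff_fam_scale \<phi>0_def)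
  moreover have "num_op \<theta> (fam_z \<phi>1) = fam_scale (of_nat 1) (fam_z \<phi>1)"
    unfolding num_op_gen[OF assms(1) td(2)] using assms(2)
    by (intro ext eq_matI) (auto simp: fam_scale_def fam_z_def \<phi>1_def)
  ultimately have "fam_z \<phi>0 \<in> num_eigenspan \<theta>" "fam_z \<phi>1 \<in> num_eigenspan \<theta>"
    using num_eigenspan.eigen fam_z_in_Z td by blast+
  moreover have "fam_z \<phi> = fam_add (fam_z \<phi>0) (fam_z \<phi>1)"
    by (intro ext eq_matI) (auto simp: fam_add_def fam_z_def \<phi>0_def \<phi>1_def)
  ultimately show ?case using num_eigenspan.add by metis
next
  case (add f g)
  then show ?case by (blast intro: num_eigenspan.add)
next
  case (mult f g)
  then show ?case by (blast intro: num_eigenspan_mult assms(1))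
qed

text \<open>Scalar multiplication on two-variable families.\<close>

definition scale2 :: "complex \<Rightarrow> 'b fam2 \<Rightarrow> 'b fam2" where
  "scale2 c \<xi> = (\<lambda>m n \<beta> \<beta>' u v. c * \<xi> m n \<beta> \<beta>' u v)"

lemma scale2_add: "scale2 c (\<xi> + \<eta>) = scale2 c \<xi> + scale2 c \<eta>"
  by (rule fam2_eqI) (simp add: scale2_def plus_fun_apply algebra_simps)

lemma scale2_add_left: "scale2 (c + d) \<xi> = scale2 c \<xi> + scale2 d \<xi>"
  by (rule fam2_eqI) (simp add: scale2_def plus_fun_apply algebra_simps)

lemma scale2_zero: "scale2 c 0 = 0"
  by (rule fam2_eqI) (simp add: scale2_def zero_fun_apply)

lemma scale2_scale2: "scale2 c (scale2 d \<xi>) = scale2 (c * d) \<xi>"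
  by (simp add: scale2_def mult.assoc)

lemma scale2_one: "scale2 1 \<xi> = \<xi>"
  by (simp add: scale2_def)

lemma scale2_eq_zero: "scale2 c \<xi> = 0 \<Longrightarrow> c \<noteq> 0 \<Longrightarrow> \<xi> = 0"
  by (simp add: scale2_def zero_fun_def fun_eq_iff)

lemma scale2_sum: "scale2 c (sum w A) = (\<Sum>k\<in>A. scale2 c (w k))"
  by (induction A rule: infinite_finite_induct) (simp_all add: scale2_zero scale2_add)

lemma scale2_tensor:
  "scale2 c (f \<otimes>\<^sub>f g) = fam_scale c f \<otimes>\<^sub>f g"
  "scale2 c (f \<otimes>\<^sub>f g) = f \<otimes>\<^sub>f fam_scale c g"
  by (rule fam2_eqI, simp add: scale2_def tensor_def coeff_fam_scale)+

lemma scale2_Z2: "\<xi> \<in> fam_Z2 \<Longrightarrow> scale2 c \<xi> \<in> fam_Z2"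
  by (induction rule: fam_Z2_induct)
    (auto simp: scale2_zero zero_in_Z2 scale2_add scale2_tensor(1) intro!: Z2_add_tensor fam_Z_scale)

lemma num_op2_scale:
  assumes "\<xi> \<in> fam_Z2" "\<theta> \<in> top_dual"
  shows "num_op2 \<theta> (scale2 c \<xi>) = scale2 c (num_op2 \<theta> \<xi>)"
  using assms(1)
proof (induction rule: fam_Z2_induct)
  case (add \<xi> f g)
  have n: "num_op \<theta> (fam_scale c f) = fam_scale c (num_op \<theta> f)"
  proof -
    have "num_op \<theta> (fam_scale c f) =
        fam_add (fam_mult (fam_scale 0 fam_one) f) (fam_mult (fam_scale c fam_one) (num_op \<theta> f))"
      using num_op_mult[of "fam_scale c fam_one" f \<theta>] add assms(2)
      by (simp add: fam_mult_const_left fam_Z_scale fam_Z_one num_op_const)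
    also have "\<dots> = fam_scale c (num_op \<theta> f)"
      using add assms(2)
      by (intro fam_Z_eqI) (simp_all add: fam_mult_const_left num_op_in_Z fam_Z_scale fam_Z_add
          coeff_fam_add coeff_fam_scale)
    finally show ?thesis .
  qed
  have "num_op2 \<theta> (scale2 c (f \<otimes>\<^sub>f g)) = scale2 c (num_op2 \<theta> (f \<otimes>\<^sub>f g))"
    using add by (simp add: scale2_tensor(1) num_op2_tensor fam_Z_scale n scale2_add)
  then show ?case
    using add by (simp add: scale2_add num_op2_add scale2_Z2 tensor_in_Z2)
qed (simp add: scale2_zero num_op2_zero)

lemma Z2_sum: "(\<And>k. k \<in> A \<Longrightarrow> w k \<in> fam_Z2) \<Longrightarrow> sum w A \<in> fam_Z2"
  by (induction A rule: infinite_finite_induct) (auto simp: zero_in_Z2 Z2_add)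

lemma num_op2_sum:
  "(\<And>k. k \<in> A \<Longrightarrow> w k \<in> fam_Z2) \<Longrightarrow> num_op2 \<theta> (sum w A) = (\<Sum>k\<in>A. num_op2 \<theta> (w k))"
  by (induction A rule: infinite_finite_induct) (simp_all add: num_op2_zero num_op2_add Z2_sum)

text \<open>
  Eigenvectors, zero included, of the number operator on the tensor square; the eigenvalue is
  \<open>k + 1\<close> because of the identity summand of \<open>num_op2\<close>.
\<close>

definition num_eigvec2 ::
    "('b::complex_unital_banach_algebra \<Rightarrow> complex) \<Rightarrow> nat \<Rightarrow> 'b fam2 \<Rightarrow> bool" where
  "num_eigvec2 \<theta> k \<xi> \<longleftrightarrow> \<xi> \<in> fam_Z2 \<and> num_op2 \<theta> \<xi> = scale2 (of_nat (Suc k)) \<xi>"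

lemma num_eigvec2_zero: "num_eigvec2 \<theta> k 0"
  by (simp add: num_eigvec2_def zero_in_Z2 num_op2_zero scale2_zero)

lemma num_eigvec2_add: "num_eigvec2 \<theta> k \<xi> \<Longrightarrow> num_eigvec2 \<theta> k \<eta> \<Longrightarrow> num_eigvec2 \<theta> k (\<xi> + \<eta>)"
  by (simp add: num_eigvec2_def Z2_add num_op2_add scale2_add)

lemma num_eigvec2_scale: "\<theta> \<in> top_dual \<Longrightarrow> num_eigvec2 \<theta> k \<xi> \<Longrightarrow> num_eigvec2 \<theta> k (scale2 c \<xi>)"
  by (simp add: num_eigvec2_def scale2_Z2 num_op2_scale scale2_scale2 mult.commute)

lemma num_eigvec2_tensor:
  assumes "f \<in> fam_Z" "g \<in> fam_Z"
    and "num_op \<theta> f = fam_scale (of_nat k) f" "num_op \<theta> g = fam_scale (of_nat l) g"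
  shows "num_eigvec2 \<theta> (k + l) (f \<otimes>\<^sub>f g)"
proof -
  have "num_op2 \<theta> (f \<otimes>\<^sub>f g) =
      scale2 (of_nat k) (f \<otimes>\<^sub>f g) + scale2 (of_nat l) (f \<otimes>\<^sub>f g) + scale2 1 (f \<otimes>\<^sub>f g)"
    using assms by (simp add: num_op2_tensor scale2_tensor(1)[symmetric] scale2_tensor(2)[symmetric]
        scale2_one)
  also have "\<dots> = scale2 (of_nat (Suc (k + l))) (f \<otimes>\<^sub>f g)"
    by (simp add: scale2_add_left[symmetric] add_ac)
  finally show ?thesis
    using assms(1,2) by (simp add: num_eigvec2_def tensor_in_Z2)
qed

text \<open>
  Decomposability into eigenvectors, one for each eigenvalue \<open>k + 1\<close>. The sequence of components is
  infinite and eventually zero so that two decompositions can be added termwise.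
\<close>

definition num_decomp ::
    "('b::complex_unital_banach_algebra \<Rightarrow> complex) \<Rightarrow> 'b fam2 \<Rightarrow> bool" where
  "num_decomp \<theta> \<xi> \<longleftrightarrow> (\<exists>K w. (\<forall>k. num_eigvec2 \<theta> k (w k)) \<and> (\<forall>k\<ge>K. w k = 0) \<and> \<xi> = (\<Sum>k<K. w k))"

lemma num_decomp_eigvec:
  assumes "num_eigvec2 \<theta> k \<xi>"
  shows "num_decomp \<theta> \<xi>"
  unfolding num_decomp_def
  using assms num_eigvec2_zero
  by (intro exI[of _ "Suc k"] exI[of _ "\<lambda>j. if j = k then \<xi> else 0"]) auto

lemma num_decomp_add:
  assumes "num_decomp \<theta> \<xi>" "num_decomp \<theta> \<eta>"
  shows "num_decomp \<theta> (\<xi> + \<eta>)"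
proof -
  obtain K w where w: "\<forall>k. num_eigvec2 \<theta> k (w k)" "\<forall>k\<ge>K. w k = 0" "\<xi> = (\<Sum>k<K. w k)"
    using assms(1) unfolding num_decomp_def by blast
  obtain L v where v: "\<forall>k. num_eigvec2 \<theta> k (v k)" "\<forall>k\<ge>L. v k = 0" "\<eta> = (\<Sum>k<L. v k)"
    using assms(2) unfolding num_decomp_def by blast
  have "\<xi> = (\<Sum>k<max K L. w k)"
    unfolding w(3) using w(2) by (intro sum.mono_neutral_left) auto
  moreover have "\<eta> = (\<Sum>k<max K L. v k)"
    unfolding v(3) using v(2) by (intro sum.mono_neutral_left) auto
  ultimately have "\<xi> + \<eta> = (\<Sum>k<max K L. w k + v k)"
    by (simp add: sum.distrib)
  then show ?thesis
    unfolding num_decomp_def using w(1,2) v(1,2)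
    by (intro exI[of _ "max K L"] exI[of _ "\<lambda>k. w k + v k"]) (auto intro: num_eigvec2_add)
qed

lemma num_decomp_tensor:
  assumes "f \<in> num_eigenspan \<theta>" "g \<in> num_eigenspan \<theta>"
  shows "num_decomp \<theta> (f \<otimes>\<^sub>f g)"
  using assms(1)
proof (induction rule: num_eigenspan.induct)
  case (eigen f k)
  show ?case
    using assms(2)
  proof (induction rule: num_eigenspan.induct)
    case (eigen g l)
    then show ?case
      using \<open>f \<in> fam_Z\<close> \<open>num_op \<theta> f = _\<close> num_eigvec2_tensor num_decomp_eigvec by blast
  next
    case (add g h)
    then show ?case by (simp add: tensor_add_right num_eigenspan_Z num_decomp_add)
  qed
next
  case (add f h)
  then show ?case by (simp add: tensor_add_left num_eigenspan_Z num_decomp_add)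
qed

lemma Z2_num_decomp:
  assumes "\<theta> \<in> top_dual" "\<theta> 1 = 1" "\<xi> \<in> fam_Z2"
  shows "num_decomp \<theta> \<xi>"
  using assms(3)
proof (induction rule: fam_Z2_induct)
  case zero
  show ?case by (rule num_decomp_eigvec[OF num_eigvec2_zero])
next
  case (add \<xi> f g)
  then show ?case
    by (intro num_decomp_add num_decomp_tensor fam_Z_subset_num_eigenspan assms)
qed

lemma num_eigvec2_independent:
  assumes "\<theta> \<in> top_dual"
  shows "(\<And>k. num_eigvec2 \<theta> k (w k)) \<Longrightarrow> (\<Sum>k<K. w k) = 0 \<Longrightarrow> k < K \<Longrightarrow> w k = 0"
proof (induction K arbitrary: w k)
  case (Suc K)
  note w = Suc.prems(1)
  have Z2: "w k \<in> fam_Z2" for k using w by (simp add: num_eigvec2_def)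
  let ?S = "\<lambda>c. scale2 c :: 'a fam2 \<Rightarrow> _"
  \<comment> \<open>Subtracting \<open>K + 1\<close> times the relation from its image removes the last eigenvector.\<close>
  have "(\<Sum>k<Suc K. ?S (of_nat (Suc k)) (w k)) = num_op2 \<theta> (\<Sum>k<Suc K. w k)"
    using w Z2 by (subst num_op2_sum) (auto simp: num_eigvec2_def)
  also have "\<dots> = 0" by (simp only: Suc.prems(2) num_op2_zero)
  finally have im: "(\<Sum>k<Suc K. ?S (of_nat (Suc k)) (w k)) = 0" .
  have "(\<Sum>k<Suc K. ?S (of_nat k - of_nat K) (w k)) =
      (\<Sum>k<Suc K. ?S (of_nat (Suc k)) (w k)) + (\<Sum>k<Suc K. ?S (- of_nat (Suc K)) (w k))"
    unfolding sum.distrib[symmetric] scale2_add_left[symmetric] by simp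
  also have "\<dots> = 0"
    unfolding scale2_sum[symmetric] im Suc.prems(2) by (simp add: scale2_zero)
  finally have "(\<Sum>k<K. ?S (of_nat k - of_nat K) (w k)) = 0"
    by (simp add: scale2_def zero_fun_def[symmetric])
  then have "?S (of_nat k - of_nat K) (w k) = 0" if "k < K" for k
    using Suc.IH[of "\<lambda>k. ?S (of_nat k - of_nat K) (w k)"] w that num_eigvec2_scale[OF assms] by blast
  then have *: "w k = 0" if "k < K" for k
    using scale2_eq_zero[of "of_nat k - of_nat K" "w k"] that by simp
  moreover have "w K = 0"
    using Suc.prems(2) * by simp
  ultimately show ?case using Suc.prems(3) by (auto simp: less_Suc_eq)
qed simp

lemma num_op2_eq_zero:
  assumes "\<theta> \<in> top_dual" "\<theta> 1 = 1" "\<xi> \<in> fam_Z2" "num_op2 \<theta> \<xi> = 0"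
  shows "\<xi> = 0"
proof -
  obtain K w where w: "\<forall>k. num_eigvec2 \<theta> k (w k)" "\<xi> = (\<Sum>k<K. w k)"
    using Z2_num_decomp[OF assms(1-3)] unfolding num_decomp_def by blast
  have "(\<Sum>k<K. scale2 (of_nat (Suc k)) (w k)) = num_op2 \<theta> \<xi>"
    unfolding w(2) using w(1) by (subst num_op2_sum) (auto simp: num_eigvec2_def)
  then have "scale2 (of_nat (Suc k)) (w k) = 0" if "k < K" for k
    using num_eigvec2_independent[OF assms(1), of "\<lambda>k. scale2 (of_nat (Suc k)) (w k)"] w(1) that
      num_eigvec2_scale[OF assms(1)] assms(4) by simp
  then have "w k = 0" if "k < K" for k
    using scale2_eq_zero that by (metis of_nat_neq_0)
  then show ?thesis unfolding w(2) by simp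
qed

lemma num_op2_inj:
  assumes "\<theta> \<in> top_dual" "\<theta> 1 = 1" "\<xi> \<in> fam_Z2" "\<eta> \<in> fam_Z2" "num_op2 \<theta> \<xi> = num_op2 \<theta> \<eta>"
  shows "\<xi> = \<eta>"
proof -
  define \<zeta> where "\<zeta> = scale2 (-1) \<eta>"
  have \<zeta>: "\<zeta> \<in> fam_Z2"
    unfolding \<zeta>_def using assms(4) by (rule scale2_Z2)
  have "scale2 1 \<eta> + \<zeta> = 0"
    unfolding \<zeta>_def scale2_add_left[symmetric] by (simp add: scale2_def zero_fun_def)
  then have neg: "\<eta> + \<zeta> = 0" by (simp only: scale2_one)
  have "num_op2 \<theta> (\<xi> + \<zeta>) = num_op2 \<theta> (\<eta> + \<zeta>)"
    by (simp only: num_op2_add[OF \<zeta>] assms(3-5))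
  also have "\<dots> = 0"
    by (simp only: neg num_op2_zero)
  finally have "\<xi> + \<zeta> = 0"
    by (rule num_op2_eq_zero[OF assms(1,2) Z2_add[OF \<zeta> assms(3)]])
  with neg have "\<xi> + \<zeta> = \<eta> + \<zeta>" by (simp only:)
  then show ?thesis by (rule add_right_imp_eq)
qed

lemma num_op2_surj:
  assumes "\<theta> \<in> top_dual" "\<theta> 1 = 1" "\<xi> \<in> fam_Z2"
  obtains \<xi>' where "\<xi>' \<in> fam_Z2" "num_op2 \<theta> \<xi>' = \<xi>"
proof -
  obtain K w where w: "\<forall>k. num_eigvec2 \<theta> k (w k)" "\<xi> = (\<Sum>k<K. w k)"
    using Z2_num_decomp[OF assms] unfolding num_decomp_def by blast
  define \<xi>' where "\<xi>' = (\<Sum>k<K. scale2 (1 / of_nat (Suc k)) (w k))"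
  have Z2: "scale2 (1 / of_nat (Suc k)) (w k) \<in> fam_Z2" for k
    using w(1) by (simp add: num_eigvec2_def scale2_Z2)
  have "num_op2 \<theta> (scale2 (1 / of_nat (Suc k)) (w k)) = w k" for k
    using w(1) assms(1) of_nat_neq_0[where 'a = complex, of k]
    by (simp add: num_eigvec2_def num_op2_scale scale2_scale2 scale2_one del: of_nat_Suc)
  then have "num_op2 \<theta> \<xi>' = \<xi>"
    unfolding \<xi>'_def w(2) num_op2_sum[OF Z2] by (intro sum.cong refl)
  moreover have "\<xi>' \<in> fam_Z2"
    unfolding \<xi>'_def by (rule Z2_sum[OF Z2])
  ultimately show ?thesis by (intro that)
qed


section \<open>Exactness\<close>

theorem theorem7p6:
  fixes \<theta> :: "'b::complex_unital_banach_algebra \<Rightarrow> complex" and \<xi> :: "'b fam2"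
  assumes "\<theta> \<in> top_dual" and "\<theta> 1 = 1" and "\<xi> \<in> fam_Z2"
  shows "((\<exists>q\<in>fam_Z. del q = \<xi>) \<longleftrightarrow> del_id \<xi> = id_del \<xi>) \<and>
         (del_id \<xi> = id_del \<xi> \<longleftrightarrow> del (del_star \<theta> \<xi>) = num_op2 \<theta> \<xi>)"
proof -
  have coassoc_imp: "del (del_star \<theta> \<eta>) = num_op2 \<theta> \<eta>"
    if "\<eta> \<in> fam_Z2" "del_id \<eta> = id_del \<eta>" for \<eta>
    using that assms(1,2) by (simp add: del_del_star_contract num_op2_contract add_ac)
  have "\<exists>q\<in>fam_Z. del q = \<xi>" if eq: "del (del_star \<theta> \<xi>) = num_op2 \<theta> \<xi>"
  proof -
    obtain \<xi>' where \<xi>': "\<xi>' \<in> fam_Z2" "num_op2 \<theta> \<xi>' = \<xi>"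
      using num_op2_surj[OF assms] by blast
    define q where "q = del_star \<theta> \<xi>'"
    have q: "q \<in> fam_Z"
      unfolding q_def using \<xi>'(1) assms(1) by (rule del_star_in_Z)
    have "num_op2 \<theta> (del q) = del (num_op \<theta> q)"
      using coassoc_imp[OF del_in_Z2[OF q] del_coassociative[OF q]] by (simp add: num_op_eq)
    also have "num_op \<theta> q = del_star \<theta> \<xi>"
      unfolding q_def num_op_del_star[OF assms(1,2) \<xi>'(1)] \<xi>'(2) ..
    finally have "num_op2 \<theta> (del q) = num_op2 \<theta> \<xi>"
      unfolding eq .
    then have "del q = \<xi>"
      by (rule num_op2_inj[OF assms(1,2) del_in_Z2[OF q] assms(3)])
    then show ?thesis using q by blast
  qed
  then show ?thesis
    using coassoc_imp[OF assms(3)] del_coassociative by blast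
qed

end
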